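(* Let $\widehat\Gamma$ be a Harnack graph with controlled, uniformly lazy weights, $K$ a set of vertices, and suppose $\Gamma:=\widehat\Gamma\setminus K$ is an infinite inner uniform subgraph of $\widehat\Gamma$. For $x\in\Gamma$, $r>0$, let $B_{\partial_I}(x,r):=B_\Gamma(x,r)\cap\partial_I\Gamma$, $V_{\partial_I}(x,r):=\pi(B_{\partial_I}(x,r))$ and $W_{\partial_I}(x,r):=V_\Gamma(x,r)/V_{\partial_I}(x,r)$. Then: (1) If $\Gamma$ is uniformly $S$-transient, there exist $L',\varepsilon'>0$ such that $d(x,K)\ge L'$ implies $\sum_{n\ge d_\Gamma^2(x,\partial_I\Gamma)}\frac{1}{W_{\partial_I}(x,\sqrt n)}\le\varepsilon'$. (2) If for every $\varepsilon>0$ there is $L_\varepsilon>0$ such that $d(x,K)\ge L_\varepsilon$ implies $\sum_{n\ge d_\Gamma^2(x,\partial_I\Gamma)}\frac{1}{W_{\partial_I}(x,\sqrt n)}\le\varepsilon$, then $\Gamma$ is uniformly $S$-transient.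
   Context: $\widehat{\Gamma}$: infinite simple connected graph with symmetric edge weights $\mu_{xy}$ ($\neq0$ iff $x\sim y$) and vertex weights $\pi>0$, $\sum_{y\sim x}\mu_{xy}\le\pi(x)$; kernel $\mathcal{K}(x,y)=\mu_{xy}/\pi(x)$ ($x\ne y$), $\mathcal{K}(x,x)=1-\sum_{z\sim x}\mu_{xz}/\pi(x)$; controlled weights ($\mu_{xy}/\pi(x)\ge1/C_c$ for $y\sim x$), uniformly lazy ($\mathcal{K}(x,x)\ge C_e>0$). Harnack graph: $p(n,x,y)=\mathcal{K}^n(x,y)/\pi(y)$ satisfies $\frac{c_1}{V(x,\sqrt n)}e^{-d(x,y)^2/(c_2n)}\le p(n,x,y)\le\frac{c_3}{V(x,\sqrt n)}e^{-d(x,y)^2/(c_4 n)}$ for $n\ge d(x,y)$ ($d$ graph distance of $\widehat\Gamma$). $\Gamma$ is the induced subgraph on the complement of $K$, $d_\Gamma$ its intrinsic graph distance, $B_\Gamma(x,r)=\{y\in\Gamma:d_\Gamma(x,y)\le r\}$, $V_\Gamma(x,r)=\pi(B_\Gamma(x,r))$. $\partial\Gamma$: vertices outside $\Gamma$ adjacent to $\Gamma$; $\partial_I\Gamma$: vertices of $\Gamma$ adjacent to a vertex outside $\Gamma$. Inner uniform: $\exists c_u,C_U>0$ such that any $x,y\in\Gamma$ are joined by a path $x_0=x,\dots,x_k=y$ in $\Gamma$ with $k\le C_Ud_\Gamma(x,y)$ and $d(x_j,\partial\Gamma)\ge c_u(1+\min\{j,k-j\})$. $\psi_K(x)=\mathbb{P}^x(\tau_K<\infty)$;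 uniformly $S$-transient: $\exists L,\varepsilon>0$ with $\psi_K(x)\le1-\varepsilon$ whenever $d(x,K)\ge L$. If $V_{\partial_I}(x,r)=0$ then $1/W_{\partial_I}(x,r)=0$. *)

theory Defs
  imports "HOL-Analysis.Analysis"
begin

text \<open>Vertex set of the ambient graph = UNIV of type 'a; adjacency adj (simple graph),
  edge weights mu, vertex weights wt, removed set K.\<close>

definition nbrs :: "('a \<Rightarrow> 'a \<Rightarrow> bool) \<Rightarrow> 'a \<Rightarrow> 'a set" where
  "nbrs adj x = {y. adj x y}"

definition walk :: "('a \<Rightarrow> 'a \<Rightarrow> bool) \<Rightarrow> 'a list \<Rightarrow> bool" where
  "walk E xs \<longleftrightarrow> xs \<noteq> [] \<and> (\<forall>i. Suc i < length xs \<longrightarrow> E (xs ! i) (xs ! Suc i))"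

definition gdist :: "('a \<Rightarrow> 'a \<Rightarrow> bool) \<Rightarrow> 'a \<Rightarrow> 'a \<Rightarrow> nat" where
  "gdist E x y = (LEAST n. \<exists>xs. walk E xs \<and> hd xs = x \<and> last xs = y \<and> length xs = Suc n)"

definition connected_graph :: "('a \<Rightarrow> 'a \<Rightarrow> bool) \<Rightarrow> bool" where
  "connected_graph E \<longleftrightarrow> (\<forall>x y. \<exists>xs. walk E xs \<and> hd xs = x \<and> last xs = y)"

definition weighted_graph ::
  "('a \<Rightarrow> 'a \<Rightarrow> bool) \<Rightarrow> ('a \<Rightarrow> 'a \<Rightarrow> real) \<Rightarrow> ('a \<Rightarrow> real) \<Rightarrow> bool" where
  "weighted_graph adj mu wt \<longleftrightarrow>
     infinite (UNIV :: 'a set) \<and>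
     (\<forall>x. \<not> adj x x) \<and> (\<forall>x y. adj x y \<longleftrightarrow> adj y x) \<and>
     connected_graph adj \<and>
     (\<forall>x. finite (nbrs adj x)) \<and>
     (\<forall>x y. mu x y = mu y x) \<and> (\<forall>x y. mu x y \<ge> 0) \<and>
     (\<forall>x y. mu x y \<noteq> 0 \<longleftrightarrow> adj x y) \<and>
     (\<forall>x. wt x > 0) \<and>
     (\<forall>x. (\<Sum>y\<in>nbrs adj x. mu x y) \<le> wt x)"

definition kern :: "('a \<Rightarrow> 'a \<Rightarrow> bool) \<Rightarrow> ('a \<Rightarrow> 'a \<Rightarrow> real) \<Rightarrow> ('a \<Rightarrow> real) \<Rightarrow> 'a \<Rightarrow> 'a \<Rightarrow> real" where
  "kern adj mu wt x y =
     (if x = y then 1 - (\<Sum>z\<in>nbrs adj x. mu x z / wt x) else mu x y / wt x)"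

primrec kpow :: "('a \<Rightarrow> 'a \<Rightarrow> bool) \<Rightarrow> ('a \<Rightarrow> 'a \<Rightarrow> real) \<Rightarrow> ('a \<Rightarrow> real) \<Rightarrow> nat \<Rightarrow> 'a \<Rightarrow> 'a \<Rightarrow> real" where
  "kpow adj mu wt 0 x y = (if x = y then 1 else 0)"
| "kpow adj mu wt (Suc n) x y =
     (\<Sum>z\<in>insert x (nbrs adj x). kern adj mu wt x z * kpow adj mu wt n z y)"

definition heat :: "('a \<Rightarrow> 'a \<Rightarrow> bool) \<Rightarrow> ('a \<Rightarrow> 'a \<Rightarrow> real) \<Rightarrow> ('a \<Rightarrow> real) \<Rightarrow> nat \<Rightarrow> 'a \<Rightarrow> 'a \<Rightarrow> real" where
  "heat adj mu wt n x y = kpow adj mu wt n x y / wt y"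

definition controlled_weights :: "('a \<Rightarrow> 'a \<Rightarrow> bool) \<Rightarrow> ('a \<Rightarrow> 'a \<Rightarrow> real) \<Rightarrow> ('a \<Rightarrow> real) \<Rightarrow> bool" where
  "controlled_weights adj mu wt \<longleftrightarrow>
     (\<exists>Cc>0. \<forall>x y. adj x y \<longrightarrow> mu x y / wt x \<ge> 1 / Cc)"

definition uniformly_lazy :: "('a \<Rightarrow> 'a \<Rightarrow> bool) \<Rightarrow> ('a \<Rightarrow> 'a \<Rightarrow> real) \<Rightarrow> ('a \<Rightarrow> real) \<Rightarrow> bool" where
  "uniformly_lazy adj mu wt \<longleftrightarrow> (\<exists>Ce>0. \<forall>x. kern adj mu wt x x \<ge> Ce)"

definition gball :: "('a \<Rightarrow> 'a \<Rightarrow> bool) \<Rightarrow> 'a \<Rightarrow> real \<Rightarrow> 'a set" where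
  "gball adj x r = {y. real (gdist adj x y) \<le> r}"

definition vol :: "('a \<Rightarrow> real) \<Rightarrow> 'a set \<Rightarrow> real" where
  "vol wt A = (\<Sum>y\<in>A. wt y)"

definition harnack_graph :: "('a \<Rightarrow> 'a \<Rightarrow> bool) \<Rightarrow> ('a \<Rightarrow> 'a \<Rightarrow> real) \<Rightarrow> ('a \<Rightarrow> real) \<Rightarrow> bool" where
  "harnack_graph adj mu wt \<longleftrightarrow>
     (\<exists>c1 c2 c3 c4. c1 > 0 \<and> c2 > 0 \<and> c3 > 0 \<and> c4 > 0 \<and>
       (\<forall>n x y. gdist adj x y \<le> n \<longrightarrow>
          c1 / vol wt (gball adj x (sqrt n)) * exp (- (real (gdist adj x y))\<^sup>2 / (c2 * n))
            \<le> heat adj mu wt n x y \<and>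
          heat adj mu wt n x y \<le>
          c3 / vol wt (gball adj x (sqrt n)) * exp (- (real (gdist adj x y))\<^sup>2 / (c4 * n))))"

definition adjG :: "'a set \<Rightarrow> ('a \<Rightarrow> 'a \<Rightarrow> bool) \<Rightarrow> 'a \<Rightarrow> 'a \<Rightarrow> bool" where
  "adjG K adj x y \<longleftrightarrow> adj x y \<and> x \<notin> K \<and> y \<notin> K"

definition dG :: "'a set \<Rightarrow> ('a \<Rightarrow> 'a \<Rightarrow> bool) \<Rightarrow> 'a \<Rightarrow> 'a \<Rightarrow> nat" where
  "dG K adj = gdist (adjG K adj)"

definition ballG :: "'a set \<Rightarrow> ('a \<Rightarrow> 'a \<Rightarrow> bool) \<Rightarrow> 'a \<Rightarrow> real \<Rightarrow> 'a set" where
  "ballG K adj x r = {y. y \<notin> K \<and> real (dG K adj x y) \<le> r}"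

definition outer_bdry :: "'a set \<Rightarrow> ('a \<Rightarrow> 'a \<Rightarrow> bool) \<Rightarrow> 'a set" where
  "outer_bdry K adj = {z. z \<in> K \<and> (\<exists>y. y \<notin> K \<and> adj z y)}"

definition inner_bdry :: "'a set \<Rightarrow> ('a \<Rightarrow> 'a \<Rightarrow> bool) \<Rightarrow> 'a set" where
  "inner_bdry K adj = {y. y \<notin> K \<and> (\<exists>z\<in>K. adj y z)}"

text \<open>d(x_j, \<partial>Gamma) \<ge> c written as: c \<le> d(x_j,z) for all z in the outer boundary
  (the infimum of a set of naturals is attained; empty boundary gives distance \<infinity>).\<close>
definition inner_uniform :: "'a set \<Rightarrow> ('a \<Rightarrow> 'a \<Rightarrow> bool) \<Rightarrow> bool" where
  "inner_uniform K adj \<longleftrightarrow>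
     (\<exists>cu CU. cu > 0 \<and> CU > 0 \<and>
       (\<forall>x y. x \<notin> K \<longrightarrow> y \<notin> K \<longrightarrow>
          (\<exists>xs. walk (adjG K adj) xs \<and> hd xs = x \<and> last xs = y \<and>
             real (length xs - 1) \<le> CU * real (dG K adj x y) \<and>
             (\<forall>j < length xs. \<forall>z\<in>outer_bdry K adj.
                cu * (1 + real (min j (length xs - 1 - j))) \<le> real (gdist adj (xs ! j) z)))))"

text \<open>P^x(tau_K \<le> n), by the standard first-step recursion.\<close>
primrec hit_prob :: "('a \<Rightarrow> 'a \<Rightarrow> bool) \<Rightarrow> ('a \<Rightarrow> 'a \<Rightarrow> real) \<Rightarrow> ('a \<Rightarrow> real) \<Rightarrow> 'a set \<Rightarrow> nat \<Rightarrow> 'a \<Rightarrow> real" where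
  "hit_prob adj mu wt K 0 x = (if x \<in> K then 1 else 0)"
| "hit_prob adj mu wt K (Suc n) x =
     (if x \<in> K then 1
      else (\<Sum>z\<in>insert x (nbrs adj x). kern adj mu wt x z * hit_prob adj mu wt K n z))"

text \<open>psi_K(x) = P^x(tau_K < \<infinity>) = sup_n P^x(tau_K \<le> n).\<close>
definition psiK :: "('a \<Rightarrow> 'a \<Rightarrow> bool) \<Rightarrow> ('a \<Rightarrow> 'a \<Rightarrow> real) \<Rightarrow> ('a \<Rightarrow> real) \<Rightarrow> 'a set \<Rightarrow> 'a \<Rightarrow> real" where
  "psiK adj mu wt K x = (SUP n. hit_prob adj mu wt K n x)"

text \<open>d(x,K) \<ge> L written as L \<le> d(x,k) for all k in K.\<close>
definition unif_S_transient :: "('a \<Rightarrow> 'a \<Rightarrow> bool) \<Rightarrow> ('a \<Rightarrow> 'a \<Rightarrow> real) \<Rightarrow> ('a \<Rightarrow> real) \<Rightarrow> 'a set \<Rightarrow> bool" where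
  "unif_S_transient adj mu wt K \<longleftrightarrow>
     (\<exists>L \<epsilon>. L > 0 \<and> \<epsilon> > 0 \<and>
        (\<forall>x. (\<forall>k\<in>K. L \<le> real (gdist adj x k)) \<longrightarrow> psiK adj mu wt K x \<le> 1 - \<epsilon>))"

definition VG :: "'a set \<Rightarrow> ('a \<Rightarrow> 'a \<Rightarrow> bool) \<Rightarrow> ('a \<Rightarrow> real) \<Rightarrow> 'a \<Rightarrow> real \<Rightarrow> real" where
  "VG K adj wt x r = vol wt (ballG K adj x r)"

definition VI :: "'a set \<Rightarrow> ('a \<Rightarrow> 'a \<Rightarrow> bool) \<Rightarrow> ('a \<Rightarrow> real) \<Rightarrow> 'a \<Rightarrow> real \<Rightarrow> real" where
  "VI K adj wt x r = vol wt (ballG K adj x r \<inter> inner_bdry K adj)"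

definition WI :: "'a set \<Rightarrow> ('a \<Rightarrow> 'a \<Rightarrow> bool) \<Rightarrow> ('a \<Rightarrow> real) \<Rightarrow> 'a \<Rightarrow> real \<Rightarrow> real" where
  "WI K adj wt x r = VG K adj wt x r / VI K adj wt x r"

definition invWI :: "'a set \<Rightarrow> ('a \<Rightarrow> 'a \<Rightarrow> bool) \<Rightarrow> ('a \<Rightarrow> real) \<Rightarrow> 'a \<Rightarrow> real \<Rightarrow> real" where
  "invWI K adj wt x r = (if VI K adj wt x r = 0 then 0 else 1 / WI K adj wt x r)"

text \<open>sum_{n \<ge> d_Gamma(x,\<partial>_I Gamma)^2} 1/W(x, sqrt n), as a sum in [0,\<infinity>];
  n \<ge> min_z d^2 iff n \<ge> d(x,z)^2 for some z (empty boundary: empty sum).\<close>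
definition bdry_sum :: "'a set \<Rightarrow> ('a \<Rightarrow> 'a \<Rightarrow> bool) \<Rightarrow> ('a \<Rightarrow> real) \<Rightarrow> 'a \<Rightarrow> ennreal" where
  "bdry_sum K adj wt x =
     (\<Sum>n. ennreal (if (\<exists>z\<in>inner_bdry K adj. (dG K adj x z)\<^sup>2 \<le> n)
                     then invWI K adj wt x (sqrt (real n)) else 0))"

end

theory Submission
  imports Defs
begin

text \<open>
  Let \<open>q\<close> be the heat kernel of the walk killed on \<open>K\<close> and \<open>A\<close> the inner boundary. A walk on \<open>A\<close>
  steps into \<open>K\<close> with probability bounded below, so the hitting probability of \<open>K\<close> from \<open>x\<close> is
  comparable to the sum of \<open>q(n,x,A)\<close> over all \<open>n\<close>, which has to be compared with the sum of
  \<open>V\<^sub>A(x,\<surd>n) / V(x,\<surd>n)\<close>.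

  Upper bound: as long as the killed walk stays in a ball of radius \<open>R\<close> of the ambient graph, its
  inner distance from the starting point is at most a constant times \<open>R\<close>. This follows by packing from
  volume doubling and the fact that inner balls contain ambient balls of comparable size. Hence
  the ambient Gaussian bounds control \<open>q\<close> in terms of the inner distance.

  Lower bound: uniform transience bounds the survival probability from below at every vertex
  of \<open>\<Gamma>\<close>. Inner uniformity makes \<open>K\<close> porous, so a surviving walk is at time \<open>n\<close> with
  positive probability at depth of order \<open>\<surd>n\<close>, and between such deep vertices \<open>q\<close> is bounded below
  by chaining the ambient near-diagonal bound along an inner uniform path. Run this from \<open>x\<close> and,
  by reversibility, from the vertices of \<open>A\<close>.
\<close>

section \<open>Graph distance\<close>

lemma walk_iff_relpowp:
  "(\<exists>xs. walk E xs \<and> hd xs = x \<and> last xs = y \<and> length xs = Suc n) \<longleftrightarrow> (E ^^ n) x y"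
proof
  assume "\<exists>xs. walk E xs \<and> hd xs = x \<and> last xs = y \<and> length xs = Suc n"
  then obtain xs where xs: "walk E xs" "hd xs = x" "last xs = y" "length xs = Suc n" by blast
  have "xs \<noteq> []" using xs(4) by auto
  then show "(E ^^ n) x y"
    using xs unfolding relpowp_fun_conv walk_def
    by (intro exI[of _ "\<lambda>i. xs ! i"]) (auto simp: hd_conv_nth last_conv_nth)
next
  assume "(E ^^ n) x y"
  then obtain f where f: "f 0 = x" "f n = y" "\<forall>i<n. E (f i) (f (Suc i))"
    unfolding relpowp_fun_conv by blast
  define xs where "xs = map f [0..<Suc n]"
  have len: "length xs = Suc n" by (simp add: xs_def)
  have nth: "xs ! i = f i" if "i < Suc n" for i
    using that unfolding xs_def by (subst nth_map) (auto simp del: upt_Suc)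
  have ne: "xs \<noteq> []" using len by auto
  have "walk E xs" unfolding walk_def using f(3) ne len nth by auto
  moreover have "hd xs = x" "last xs = y"
    using f ne len nth by (auto simp: hd_conv_nth last_conv_nth)
  ultimately show "\<exists>xs. walk E xs \<and> hd xs = x \<and> last xs = y \<and> length xs = Suc n"
    using len by blast
qed

lemma gdist_relpowp: "gdist E x y = (LEAST n. (E ^^ n) x y)"
  unfolding gdist_def walk_iff_relpowp ..

lemma gdist_le: "(E ^^ n) x y \<Longrightarrow> gdist E x y \<le> n"
  unfolding gdist_relpowp by (rule Least_le)

lemma relpowp_gdist: "E\<^sup>*\<^sup>* x y \<Longrightarrow> (E ^^ gdist E x y) x y"
  unfolding gdist_relpowp by (metis LeastI rtranclp_imp_relpowp)

lemma gdist_refl [simp]: "gdist E x x = 0"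
  using gdist_le[of 0 E x x] by simp

lemma gdist_triangle:
  assumes "E\<^sup>*\<^sup>* x y" "E\<^sup>*\<^sup>* y z"
  shows "gdist E x z \<le> gdist E x y + gdist E y z"
  by (rule gdist_le) (use relpowp_gdist[OF assms(1)] relpowp_gdist[OF assms(2)] in
      \<open>auto simp: relpowp_add\<close>)

lemma relpowp_sym:
  assumes "\<And>x y. E x y \<Longrightarrow> E y x"
  shows "(E ^^ n) x y \<Longrightarrow> (E ^^ n) y x"
proof (induction n arbitrary: y)
  case (Suc n)
  then obtain z where "(E ^^ n) x z" "E z y" by auto
  with Suc.IH assms show ?case by (metis relpowp_Suc_I2)
qed auto

lemma gdist_commute:
  assumes "\<And>x y. E x y \<Longrightarrow> E y x"
  shows "gdist E x y = gdist E y x"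
  unfolding gdist_relpowp using relpowp_sym[of E, OF assms] by metis

lemma gdist_eq_0_iff: "E\<^sup>*\<^sup>* x y \<Longrightarrow> gdist E x y = 0 \<longleftrightarrow> x = y"
  using relpowp_gdist[of E x y] by (metis gdist_refl relpowp_0_E)

lemma walk_nth_relpowp:
  assumes "walk E xs" "i \<le> j" "j < length xs"
  shows "(E ^^ (j - i)) (xs ! i) (xs ! j)"
  unfolding relpowp_fun_conv
  by (rule exI[of _ "\<lambda>k. xs ! (i + k)"]) (use assms in \<open>auto simp: walk_def\<close>)

lemma walk_relpowp_ends:
  assumes "walk E xs"
  shows "(E ^^ (length xs - 1)) (hd xs) (last xs)"
proof -
  have "xs \<noteq> []" using assms by (simp add: walk_def)
  then show ?thesis
    using walk_nth_relpowp[OF assms, of 0 "length xs - 1"]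
    by (simp add: hd_conv_nth last_conv_nth)
qed

lemma finite_relpowp:
  fixes E :: "'a \<Rightarrow> 'a \<Rightarrow> bool"
  assumes "\<And>x. finite {y. E x y}"
  shows "finite {y. (E ^^ n) x y}"
proof (induction n)
  case (Suc n)
  have "{y. (E ^^ Suc n) x y} = (\<Union>z\<in>{z. (E ^^ n) x z}. {y. E z y})"
    by auto
  then show ?case using Suc assms by simp
qed simp

section \<open>The killed random walk\<close>

locale wgraph =
  fixes adj :: "'a \<Rightarrow> 'a \<Rightarrow> bool" and mu :: "'a \<Rightarrow> 'a \<Rightarrow> real" and wt :: "'a \<Rightarrow> real"
  assumes weighted: "weighted_graph adj mu wt"
begin

abbreviation "d \<equiv> gdist adj"
abbreviation "P \<equiv> kern adj mu wt"
abbreviation "N x \<equiv> insert x (nbrs adj x)"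
abbreviation "B \<equiv> gball adj"
abbreviation "V x r \<equiv> vol wt (gball adj x r)"
abbreviation "hit \<equiv> hit_prob adj mu wt"

lemma adj_irrefl: "\<not> adj x x"
  and adj_sym: "adj x y \<longleftrightarrow> adj y x"
  and finite_nbrs [simp, intro]: "finite (nbrs adj x)"
  and mu_sym: "mu x y = mu y x"
  and mu_nonneg: "mu x y \<ge> 0"
  and mu_nz: "mu x y \<noteq> 0 \<longleftrightarrow> adj x y"
  and wt_pos [simp]: "wt x > 0"
  and mu_sum: "(\<Sum>y\<in>nbrs adj x. mu x y) \<le> wt x"
  using weighted unfolding weighted_graph_def by blast+

lemma wt_nonneg [simp]: "wt x \<ge> 0" and wt_nz [simp]: "wt x \<noteq> 0"
  using wt_pos[of x] by (linarith, metis less_irrefl)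

lemma adj_conn: "adj\<^sup>*\<^sup>* x y"
proof -
  have "connected_graph adj" using weighted unfolding weighted_graph_def by blast
  then obtain xs where xs: "walk adj xs" "hd xs = x" "last xs = y"
    unfolding connected_graph_def by blast
  then have "length xs = Suc (length xs - 1)" by (cases xs) (auto simp: walk_def)
  with xs have "\<exists>ys. walk adj ys \<and> hd ys = x \<and> last ys = y \<and> length ys = Suc (length xs - 1)"
    by (intro exI[of _ xs]) simp
  then have "(adj ^^ (length xs - 1)) x y" unfolding walk_iff_relpowp .
  then show ?thesis by (rule relpowp_imp_rtranclp)
qed

lemma d_triangle: "d x z \<le> d x y + d y z"
  by (rule gdist_triangle) (rule adj_conn)+

lemma d_commute: "d x y = d y x"
  using gdist_commute[of adj] adj_sym by blast

lemma d_eq_0_iff [simp]: "d x y = 0 \<longleftrightarrow> x = y"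
  by (rule gdist_eq_0_iff) (rule adj_conn)

lemma mem_ball [simp]: "y \<in> B x r \<longleftrightarrow> real (d x y) \<le> r"
  by (simp add: gball_def)

lemma finite_ball [simp, intro]: "finite (B x r)"
proof -
  have "B x r \<subseteq> (\<Union>n\<in>{..nat \<lfloor>r\<rfloor>}. {y. (adj ^^ n) x y})"
    using relpowp_gdist[OF adj_conn] by (force simp: le_nat_floor)
  moreover have "finite {y. adj x y}" for x using finite_nbrs[of x] by (simp add: nbrs_def)
  ultimately show ?thesis
    by (meson finite_UN_I finite_atMost finite_relpowp finite_subset)
qed

lemma finite_ball_Collect [simp, intro]: "finite {z. real (d x z) \<le> r \<and> Q z}"
  by (rule finite_subset[OF _ finite_ball[of x r]]) auto

lemma vol_mono: "finite T \<Longrightarrow> S \<subseteq> T \<Longrightarrow> vol wt S \<le> vol wt T"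
  unfolding vol_def by (rule sum_mono2) auto

lemma vol_nonneg [simp]: "vol wt S \<ge> 0"
  unfolding vol_def by (rule sum_nonneg) auto

lemma vol_UN_le:
  assumes "finite I" "\<And>i. i \<in> I \<Longrightarrow> finite (A i)"
  shows "vol wt (\<Union>i\<in>I. A i) \<le> (\<Sum>i\<in>I. vol wt (A i))"
  using assms
proof (induction I rule: finite_induct)
  case (insert i I)
  have "vol wt (A i \<union> (\<Union>j\<in>I. A j)) \<le> vol wt (A i) + vol wt (\<Union>j\<in>I. A j)"
    unfolding vol_def using insert by (subst sum.union_inter[symmetric]) (auto intro!: sum_nonneg)
  with insert show ?case by auto
qed (simp add: vol_def)

lemma ball_mono: "r \<le> s \<Longrightarrow> B x r \<subseteq> B x s"
  by auto

lemma V_mono: "r \<le> s \<Longrightarrow> V x r \<le> V x s"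
  by (intro vol_mono ball_mono) auto

lemma V_translate: "real (d x y) + r \<le> s \<Longrightarrow> V y r \<le> V x s"
proof (intro vol_mono finite_ball subsetI)
  fix z assume "real (d x y) + r \<le> s" "z \<in> B y r"
  with d_triangle[of x z y] show "z \<in> B x s" by auto
qed

lemma wt_le_vol: "finite S \<Longrightarrow> x \<in> S \<Longrightarrow> wt x \<le> vol wt S"
  unfolding vol_def by (rule member_le_sum) auto

lemma wt_le_V: "r \<ge> 0 \<Longrightarrow> wt x \<le> V x r"
  by (rule wt_le_vol) auto

lemma V_pos: "r \<ge> 0 \<Longrightarrow> V x r > 0"
  using wt_le_V[of r x] wt_pos[of x] by linarith

lemma P_diag: "P x x = 1 - (\<Sum>y\<in>nbrs adj x. mu x y) / wt x"
  by (simp add: kern_def sum_divide_distrib)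

lemma P_nonneg [simp]: "P x y \<ge> 0"
  using mu_sum[of x] mu_nonneg by (cases "x = y") (auto simp: P_diag, auto simp: kern_def)

lemma P_zero: "y \<notin> N x \<Longrightarrow> P x y = 0"
  using mu_nz[of x y] by (auto simp: kern_def nbrs_def)

lemma P_reversible: "wt x * P x y = wt y * P y x"
  using mu_sym[of x y] by (auto simp: kern_def)

lemma P_sum [simp]: "(\<Sum>z\<in>N x. P x z) = 1"
proof -
  have "x \<notin> nbrs adj x" using adj_irrefl by (auto simp: nbrs_def)
  then have "(\<Sum>z\<in>N x. P x z) = P x x + (\<Sum>z\<in>nbrs adj x. P x z)" by simp
  also have "(\<Sum>z\<in>nbrs adj x. P x z) = (\<Sum>z\<in>nbrs adj x. mu x z / wt x)"
    using \<open>x \<notin> nbrs adj x\<close> by (intro sum.cong) (auto simp: kern_def)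
  finally show ?thesis by (simp add: P_diag sum_divide_distrib)
qed

text \<open>The expectation of \<open>f\<close> at time \<open>n\<close> over the event that the walk from \<open>x\<close> stays in \<open>S\<close>
  at all times \<open>0, \<dots>, n\<close>.\<close>

primrec killed :: "'a set \<Rightarrow> nat \<Rightarrow> ('a \<Rightarrow> real) \<Rightarrow> 'a \<Rightarrow> real" where
  "killed S 0 f x = (if x \<in> S then f x else 0)"
| "killed S (Suc n) f x = (if x \<in> S then (\<Sum>z\<in>N x. P x z * killed S n f z) else 0)"

abbreviation "q S n x y \<equiv> killed S n (indicator {y}) x"

lemma killed_outside: "x \<notin> S \<Longrightarrow> killed S n f x = 0"
  by (cases n) auto

lemma killed_mono: "(\<And>y. y \<in> S \<Longrightarrow> f y \<le> g y) \<Longrightarrow> killed S n f x \<le> killed S n g x"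
  by (induction n arbitrary: x) (auto intro!: sum_mono mult_left_mono)

lemma killed_zero [simp]: "killed S n (\<lambda>_. 0) x = 0"
  by (induction n arbitrary: x) auto

lemma killed_nonneg: "(\<And>y. y \<in> S \<Longrightarrow> 0 \<le> f y) \<Longrightarrow> 0 \<le> killed S n f x"
  using killed_mono[of S "\<lambda>_. 0" f n x] by simp

lemma q_nonneg [simp]: "0 \<le> q S n x y"
  by (rule killed_nonneg) auto

lemma killed_add: "killed S n (\<lambda>y. f y + g y) x = killed S n f x + killed S n g x"
  by (induction n arbitrary: x) (auto simp: algebra_simps sum.distrib)

lemma killed_cmult: "killed S n (\<lambda>y. c * f y) x = c * killed S n f x"
  by (induction n arbitrary: x) (auto simp: sum_distrib_left mult_ac)

lemma killed_sum: "killed S n (\<lambda>y. \<Sum>i\<in>I. f i y) x = (\<Sum>i\<in>I. killed S n (f i) x)"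
proof (induction n arbitrary: x)
  case (Suc n)
  show ?case
    unfolding killed.simps Suc.IH sum_distrib_left
    by (subst sum.swap) auto
qed auto

lemma killed_comp: "killed S (m + n) f x = killed S m (killed S n f) x"
proof (induction m arbitrary: x)
  case 0
  then show ?case by (cases n) auto
qed auto

lemma killed_subset:
  assumes "S \<subseteq> T" "\<And>y. y \<in> T \<Longrightarrow> 0 \<le> f y"
  shows "killed S n f x \<le> killed T n f x"
proof (induction n arbitrary: x)
  case (Suc n)
  have "0 \<le> killed T n f z" for z by (rule killed_nonneg) (use assms in auto)
  then show ?case using Suc assms(1)
    by (auto intro!: sum_mono mult_left_mono sum_nonneg)
qed (use assms in auto)

lemma killed_const_UNIV [simp]: "killed UNIV n (\<lambda>_. c) x = c"
  by (induction n arbitrary: x) (auto simp: sum_distrib_right[symmetric])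

lemma killed_le_const:
  assumes "\<And>y. y \<in> S \<Longrightarrow> f y \<le> c" "0 \<le> c"
  shows "killed S n f x \<le> c"
  using killed_mono[of S f "\<lambda>_. c" n x] killed_subset[of S UNIV "\<lambda>_. c" n x] assms by simp

lemma killed_cong:
  assumes "\<And>m y. m \<le> n \<Longrightarrow> (adjG (-S) adj ^^ m) x y \<Longrightarrow> y \<in> S \<Longrightarrow> f y = g y"
  shows "killed S n f x = killed S n g x"
  using assms
proof (induction n arbitrary: x)
  case 0
  then show ?case using 0[of 0 x] by auto
next
  case (Suc n)
  have "killed S n f z = killed S n g z" if "z \<in> N x" "x \<in> S" for z
  proof (cases "z \<in> S")
    case True
    show ?thesis
    proof (rule Suc.IH)
      fix m y assume m: "m \<le> n" "(adjG (-S) adj ^^ m) z y" "y \<in> S"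
      show "f y = g y"
      proof (cases "z = x")
        case True then show ?thesis using Suc.prems[of m y] m by auto
      next
        case False
        then have "adjG (-S) adj x z" using that True by (auto simp: adjG_def nbrs_def)
        then have "(adjG (-S) adj ^^ Suc m) x y" using m(2) by (rule relpowp_Suc_I2)
        then show ?thesis using Suc.prems[of "Suc m" y] m by auto
      qed
    qed
  qed (simp add: killed_outside)
  then show ?case by (auto intro!: sum.cong)
qed

lemma killed_expand_finite:
  assumes "finite F" "\<And>v. v \<in> S \<Longrightarrow> v \<notin> F \<Longrightarrow> f v = 0"
  shows "killed S n f x = (\<Sum>y\<in>F. q S n x y * f y)"
proof -
  have "killed S n f x = killed S n (\<lambda>v. \<Sum>y\<in>F. f y * indicator {y} v) x"
  proof (rule killed_cong)
    fix v assume "v \<in> S"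
    have "(\<Sum>y\<in>F. f y * indicator {y} v) = (\<Sum>y\<in>F. if y = v then f v else 0)"
      by (intro sum.cong) (auto simp: indicator_def)
    also have "\<dots> = f v" using assms \<open>v \<in> S\<close> by auto
    finally show "f v = (\<Sum>y\<in>F. f y * indicator {y} v)" by simp
  qed
  also have "\<dots> = (\<Sum>y\<in>F. q S n x y * f y)"
    by (simp add: killed_sum killed_cmult mult.commute)
  finally show ?thesis .
qed

lemma q_zero_dG:
  assumes "n < dG K adj x y"
  shows "q (-K) n x y = 0"
proof -
  have "q (-K) n x y = killed (-K) n (\<lambda>_. 0) x"
    by (rule killed_cong) (use assms gdist_le[of _ "adjG K adj" x] in
      \<open>fastforce simp: dG_def indicator_def\<close>)
  then show ?thesis by simp
qed

lemma q_zero: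
  assumes "n < d x y"
  shows "q S n x y = 0"
proof -
  have "q S n x y \<le> q UNIV n x y" by (rule killed_subset) auto
  also have "adjG {} adj = adj" by (intro ext) (simp add: adjG_def)
  then have "q UNIV n x y = 0" using q_zero_dG[of n "{}" x y] assms by (simp add: dG_def)
  finally show ?thesis using q_nonneg[of S n y x] by linarith
qed

lemma killed_expand:
  "real n \<le> r \<Longrightarrow> killed S n f x = (\<Sum>y\<in>B x r. q S n x y * f y)"
proof -
  assume r: "real n \<le> r"
  have "killed S n f x = killed S n (\<lambda>y. indicator (B x r) y * f y) x"
  proof (rule killed_cong)
    fix m y assume m: "m \<le> n" "(adjG (-S) adj ^^ m) x y"
    have "(adj ^^ m) x y"
      by (rule relpowp_mono[OF _ m(2)]) (simp add: adjG_def)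
    then show "f y = indicator (B x r) y * f y"
      using gdist_le[of m adj x y] m r by (auto simp: indicator_def)
  qed
  also have "\<dots> = (\<Sum>y\<in>B x r. q S n x y * f y)"
    by (subst killed_expand_finite[where F = "B x r"]) (auto simp: indicator_def intro!: sum.cong)
  finally show ?thesis .
qed

lemma kpow_eq_q: "kpow adj mu wt n x y = q UNIV n x y"
  by (induction n arbitrary: x) (auto simp: indicator_def)

lemma q_Chapman_ge:
  assumes "finite U"
  shows "(\<Sum>u\<in>U. q S m x u * q S n u y) \<le> q S (m + n) x y"
proof -
  have "(\<Sum>u\<in>U. q S m x u * q S n u y) = (\<Sum>u\<in>U. q S m x u * (indicator U u * q S n u y))"
    by (intro sum.cong) auto
  also have "\<dots> = killed S m (\<lambda>u. indicator U u * q S n u y) x"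
    by (rule killed_expand_finite[OF assms, symmetric]) auto
  also have "\<dots> \<le> killed S m (\<lambda>u. q S n u y) x"
    by (rule killed_mono) (auto simp: indicator_def)
  also have "\<dots> = q S (m + n) x y" by (simp only: killed_comp)
  finally show ?thesis .
qed

lemma q_Suc_right:
  "q S (Suc n) x y = (\<Sum>z\<in>N y. q S n x z * q S 1 z y)"
proof -
  have "q S (Suc n) x y = killed S n (\<lambda>z. q S 1 z y) x"
    using killed_comp[of S n 1] by (simp del: killed.simps)
  also have "\<dots> = (\<Sum>z\<in>N y. q S n x z * q S 1 z y)"
  proof (rule killed_expand_finite)
    fix v assume "v \<notin> N y"
    then have "y \<notin> N v" using adj_sym by (auto simp: nbrs_def)
    then show "q S 1 v y = 0" by (auto intro!: sum.neutral simp: indicator_def)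
  qed auto
  finally show ?thesis .
qed

lemma q_1: "q S 1 x y = (if x \<in> S \<and> y \<in> S then P x y else 0)"
proof -
  have "(\<Sum>z\<in>N x. P x z * (if z \<in> S then indicator {y} z else 0)) =
        (\<Sum>z\<in>N x. if z = y then (if y \<in> S then P x y else 0) else 0)"
    by (intro sum.cong) (auto simp: indicator_def)
  also have "\<dots> = (if y \<in> S then P x y else 0)"
    using P_zero[of y x] by (subst sum.delta) auto
  finally show ?thesis by simp
qed

lemma q_reversible: "wt x * q S n x y = wt y * q S n y x"
proof (induction n arbitrary: x y)
  case 0
  then show ?case by (auto simp: indicator_def)
next
  case (Suc n)
  have "wt x * q S (Suc n) x y = (\<Sum>z\<in>N x. wt x * q S 1 x z * q S n z y)"
  proof (cases "x \<in> S")
    case True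
    then show ?thesis
      by (subst killed.simps(2)) (auto simp: sum_distrib_left q_1[unfolded One_nat_def]
          killed_outside mult_ac simp del: sum.insert killed.simps intro!: sum.cong)
  qed (simp add: killed_outside)
  also have "\<dots> = (\<Sum>z\<in>N x. wt z * q S n z y * q S 1 z x)"
  proof (intro sum.cong refl)
    fix z
    have "wt x * q S 1 x z = wt z * q S 1 z x" unfolding q_1 using P_reversible[of x z] by auto
    then show "wt x * q S 1 x z * q S n z y = wt z * q S n z y * q S 1 z x" by simp
  qed
  also have "\<dots> = (\<Sum>z\<in>N x. wt y * (q S n y z * q S 1 z x))"
    by (intro sum.cong refl) (metis Suc mult.assoc)
  also have "\<dots> = wt y * q S (Suc n) y x"
    by (simp only: q_Suc_right sum_distrib_left)
  finally show ?case .
qed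

lemma hit_eq_killed: "hit S n x = 1 - killed (-S) n (\<lambda>_. 1) x"
proof (induction n arbitrary: x)
  case (Suc n)
  show ?case
    by (auto simp: Suc right_diff_distrib sum_subtractf simp del: sum.insert)
qed simp

lemma hit_nonneg [simp]: "0 \<le> hit S n x"
  using killed_le_const[of "-S" "\<lambda>_. 1" 1 n x] by (simp add: hit_eq_killed)

lemma hit_le_1: "hit S n x \<le> 1"
  using killed_nonneg[of "-S" "\<lambda>_. 1" n x] by (simp add: hit_eq_killed)

lemma hit_inside: "x \<in> S \<Longrightarrow> hit S n x = 1"
  by (cases n) auto

lemma hit_Suc_ge: "hit S n x \<le> hit S (Suc n) x"
proof (induction n arbitrary: x)
  case 0
  show ?case by (cases "x \<in> S") (simp, use hit_nonneg[of S "Suc 0" x] in \<open>simp del: hit_prob.simps(2)\<close>)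
next
  case (Suc n)
  show ?case
    by (subst (1 2) hit_prob.simps(2)) (auto simp del: sum.insert hit_prob.simps intro!: sum_mono mult_left_mono Suc)
qed

lemma killed_le_killed_plus_exit:
  assumes "\<And>m z. m \<le> n \<Longrightarrow> z \<notin> S \<Longrightarrow> killed UNIV m f z \<le> a"
  shows "killed UNIV n f x \<le> killed S n f x + a * hit (-S) n x"
  using assms
proof (induction n arbitrary: x)
  case 0
  then show ?case using 0[of 0 x] by auto
next
  case (Suc n)
  show ?case
  proof (cases "x \<in> S")
    case True
    have "(\<Sum>z\<in>N x. P x z * killed UNIV n f z) \<le>
        (\<Sum>z\<in>N x. P x z * (killed S n f z + a * hit (-S) n z))"
      by (intro sum_mono mult_left_mono Suc.IH Suc.prems) auto
    also have "\<dots> = killed S (Suc n) f x + a * hit (-S) (Suc n) x"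
      using True by (simp add: sum.distrib sum_distrib_left distrib_left mult_ac del: sum.insert)
    finally show ?thesis by (simp del: sum.insert)
  next
    case False
    then show ?thesis using Suc.prems[of "Suc n" x] by (simp add: killed_outside hit_inside del: killed.simps hit_prob.simps)
  qed
qed

lemma exit_le_killed:
  assumes "\<And>m z. m \<le> n \<Longrightarrow> z \<notin> S \<Longrightarrow> a \<le> killed UNIV m f z" "\<And>y. 0 \<le> f y"
  shows "a * hit (-S) n x \<le> killed UNIV n f x"
proof -
  have "- killed UNIV n f x = killed UNIV n (\<lambda>y. - f y) x" for n x
    using killed_cmult[of UNIV n "-1" f x] by simp
  then have "- killed UNIV n f x \<le> killed S n (\<lambda>y. - f y) x + (- a) * hit (-S) n x"
    using killed_le_killed_plus_exit[of n S "\<lambda>y. - f y" "- a" x] assms(1) by (metis neg_le_iff_le)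
  moreover have "killed S n (\<lambda>y. - f y) x \<le> 0"
    by (rule killed_le_const) (use assms(2) in auto)
  ultimately show ?thesis by simp
qed

text \<open>Before leaving \<open>S\<close>, the walk killed on \<open>K\<close> stays in any set \<open>C\<close> that can only be left
  through \<open>K\<close> or by leaving \<open>S\<close>.\<close>

lemma killed_component_le_exit:
  assumes "x \<in> C" and C: "\<And>y z. y \<in> C \<Longrightarrow> z \<in> N y \<Longrightarrow> z \<in> C \<or> z \<in> K \<or> z \<notin> S" and "C \<inter> F = {}"
  shows "killed (-K) n (indicator F) x \<le> hit (-S) n x"
  using \<open>x \<in> C\<close>
proof (induction n arbitrary: x)
  case 0
  then show ?case using \<open>C \<inter> F = {}\<close> by (auto simp: indicator_def)
next
  case (Suc n)
  show ?case
  proof (cases "x \<in> S \<and> x \<notin> K")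
    case True
    have "killed (-K) n (indicator F) z \<le> hit (-S) n z" if "z \<in> N x" for z
    proof -
      have "z \<in> C \<or> z \<in> K \<or> z \<notin> S" using C[of x z] Suc.prems that by blast
      then consider "z \<in> C" | "z \<in> K" | "z \<notin> S" by blast
      then show ?thesis
      proof cases
        case 3
        have "killed (-K) n (indicator F) z \<le> 1" by (rule killed_le_const) (auto simp: indicator_def)
        with 3 show ?thesis by (simp add: hit_inside)
      qed (use Suc.IH in \<open>auto simp: killed_outside\<close>)
    qed
    then show ?thesis using True
      by (auto simp del: sum.insert intro!: sum_mono mult_left_mono)
  next
    case False
    have "killed (-K) (Suc n) (indicator F) x \<le> 1" by (rule killed_le_const) (auto simp: indicator_def)
    with False show ?thesis
      by (auto simp: hit_inside killed_outside simp del: killed.simps hit_prob.simps)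
  qed
qed

end

section \<open>Harnack graphs\<close>

locale harnack = wgraph adj mu wt
  for adj :: "'a \<Rightarrow> 'a \<Rightarrow> bool" and mu :: "'a \<Rightarrow> 'a \<Rightarrow> real" and wt :: "'a \<Rightarrow> real" +
  fixes Cc c1 c2 c3 c4 :: real
  assumes Cc_pos: "Cc > 0" and controlled: "\<And>x y. adj x y \<Longrightarrow> 1 / Cc \<le> mu x y / wt x"
    and c_pos: "c1 > 0" "c2 > 0" "c3 > 0" "c4 > 0"
    and heat_lower: "\<And>n x y. d x y \<le> n \<Longrightarrow>
      c1 / V x (sqrt n) * exp (- (real (d x y))\<^sup>2 / (c2 * n)) \<le> heat adj mu wt n x y"
    and heat_upper: "\<And>n x y. d x y \<le> n \<Longrightarrow>
      heat adj mu wt n x y \<le> c3 / V x (sqrt n) * exp (- (real (d x y))\<^sup>2 / (c4 * n))"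
begin

lemma q_lower:
  "d x y \<le> n \<Longrightarrow> wt y * (c1 / V x (sqrt n) * exp (- (real (d x y))\<^sup>2 / (c2 * n))) \<le> q UNIV n x y"
  using heat_lower[of x y n] by (simp add: heat_def kpow_eq_q field_simps)

lemma q_le_UNIV: "q S n x y \<le> q UNIV n x y"
  by (rule killed_subset) auto

lemma q_upper:
  "q S n x y \<le> wt y * (c3 / V x (sqrt n) * exp (- (real (d x y))\<^sup>2 / (c4 * n)))"
proof (cases "d x y \<le> n")
  case True
  have "q UNIV n x y \<le> wt y * (c3 / V x (sqrt n) * exp (- (real (d x y))\<^sup>2 / (c4 * n)))"
    using heat_upper[OF True] by (simp add: heat_def kpow_eq_q field_simps)
  with q_le_UNIV[of S n y x] show ?thesis by linarith
next
  case False
  then show ?thesis using c_pos V_pos[of "sqrt n" x]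
    by (auto simp: q_zero intro!: mult_nonneg_nonneg)
qed

lemma q_upper_left: "q S n x y \<le> c3 * wt y / V x (sqrt n)"
proof -
  have "exp (- (real (d x y))\<^sup>2 / (c4 * n)) \<le> 1" using c_pos by simp
  then have "wt y * (c3 / V x (sqrt n) * exp (- (real (d x y))\<^sup>2 / (c4 * n)))
    \<le> wt y * (c3 / V x (sqrt n) * 1)"
    by (intro mult_left_mono) (use c_pos in auto)
  with q_upper[of S n y x] show ?thesis by (simp add: mult.commute)
qed

lemma killed_indicator_le:
  assumes "finite E"
  shows "killed S n (indicator E) x \<le> c3 * vol wt E / V x (sqrt n)"
proof -
  have "killed S n (indicator E) x = (\<Sum>y\<in>E. q S n x y * indicator E y)"
    by (rule killed_expand_finite[OF assms]) auto
  also have "\<dots> \<le> (\<Sum>y\<in>E. c3 * wt y / V x (sqrt n))"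
    by (rule sum_mono) (use q_upper_left in simp)
  also have "\<dots> = c3 * vol wt E / V x (sqrt n)" by (simp add: vol_def sum_distrib_left sum_divide_distrib)
  finally show ?thesis .
qed

lemma q_upper_sym:
  "q S n x y \<le> wt y * (c3 / V y (sqrt n) * exp (- (real (d x y))\<^sup>2 / (c4 * n)))"
proof -
  have "wt x * q S n x y \<le> wt x * (wt y * (c3 / V y (sqrt n) * exp (- (real (d x y))\<^sup>2 / (c4 * n))))"
    using mult_left_mono[OF q_upper[of S n x y], of "wt y"] d_commute[of x y]
    by (simp add: q_reversible[of x S n y] mult_ac)
  then show ?thesis using wt_pos[of x] by (simp only: mult_le_cancel_left_pos)
qed

lemma q_upper_right: "q S n x y \<le> c3 * wt y / V y (sqrt n)"
proof -
  have "wt x * q S n x y \<le> wt x * (c3 * wt y / V y (sqrt n))"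
    using mult_left_mono[OF q_upper_left[of S n x y], of "wt y"]
    by (simp add: q_reversible[of x S n y] mult_ac)
  then show ?thesis using wt_pos[of x] by (simp only: mult_le_cancel_left_pos)
qed

lemma q_lower_sym:
  assumes "d x y \<le> n"
  shows "wt y * (c1 / V y (sqrt n) * exp (- (real (d x y))\<^sup>2 / (c2 * n))) \<le> q UNIV n x y"
proof -
  have "wt x * (wt y * (c1 / V y (sqrt n) * exp (- (real (d x y))\<^sup>2 / (c2 * n)))) \<le> wt x * q UNIV n x y"
    using mult_left_mono[OF q_lower[of y x n], of "wt y"] d_commute[of x y] assms
    by (simp add: q_reversible[of x UNIV n y] mult_ac)
  then show ?thesis using wt_pos[of x] by (simp only: mult_le_cancel_left_pos)
qed

lemma mu_le_wt: "mu x y \<le> wt x"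
proof (cases "adj x y")
  case True
  have "mu x y \<le> (\<Sum>y\<in>nbrs adj x. mu x y)"
    by (rule member_le_sum) (use True mu_nonneg finite_nbrs[of x] in \<open>auto simp: nbrs_def\<close>)
  with mu_sum[of x] show ?thesis by linarith
next
  case False
  then have "mu x y = 0" using mu_nz by blast
  then show ?thesis by simp
qed

lemma wt_adj: "adj x y \<Longrightarrow> wt y \<le> Cc * wt x"
proof -
  assume "adj x y"
  then have "wt y \<le> Cc * mu y x"
    using controlled[of y x] adj_sym[of x y] Cc_pos by (simp add: field_simps)
  also have "\<dots> \<le> Cc * wt x" using mu_le_wt[of x y] mu_sym[of x y] Cc_pos by simp
  finally show ?thesis .
qed

lemma P_adj_ge: "adj x y \<Longrightarrow> 1 / Cc \<le> P x y"
  using controlled[of x y] adj_irrefl[of x] by (auto simp: kern_def)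

lemma vol_nbrs: "vol wt (N x) \<le> (1 + Cc\<^sup>2) * wt x"
proof -
  have "real (card (nbrs adj x)) * (wt x / Cc) = (\<Sum>y\<in>nbrs adj x. wt x / Cc)" by simp
  also have "\<dots> \<le> (\<Sum>y\<in>nbrs adj x. mu x y)"
    by (rule sum_mono) (use controlled Cc_pos in \<open>auto simp: nbrs_def field_simps\<close>)
  also have "\<dots> \<le> wt x" by (rule mu_sum)
  finally have card: "real (card (nbrs adj x)) \<le> Cc"
    using Cc_pos by (simp add: field_simps)
  have "vol wt (N x) = wt x + (\<Sum>y\<in>nbrs adj x. wt y)"
    unfolding vol_def using adj_irrefl by (simp add: nbrs_def finite_nbrs[unfolded nbrs_def])
  also have "(\<Sum>y\<in>nbrs adj x. wt y) \<le> (\<Sum>y\<in>nbrs adj x. Cc * wt x)"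
    by (rule sum_mono) (auto simp: nbrs_def wt_adj)
  also have "\<dots> = real (card (nbrs adj x)) * (Cc * wt x)" by simp
  also have "\<dots> \<le> Cc * (Cc * wt x)"
    by (rule mult_right_mono[OF card]) (use Cc_pos in auto)
  finally show ?thesis by (simp add: algebra_simps power2_eq_square)
qed

lemma V_nat: "V x (real m) \<le> (1 + Cc\<^sup>2) ^ m * wt x"
proof (induction m)
  case 0
  have "B x (real 0) = {x}" by auto
  then show ?case by (simp add: vol_def)
next
  case (Suc m)
  have sub: "B x (real (Suc m)) \<subseteq> (\<Union>y\<in>B x (real m). N y)"
  proof
    fix y assume y: "y \<in> B x (real (Suc m))"
    show "y \<in> (\<Union>y\<in>B x (real m). N y)"
    proof (cases "d x y \<le> m")
      case False
      then have "d x y = Suc m" using y by simp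
      then have "(adj ^^ Suc m) x y" using relpowp_gdist[OF adj_conn, of x y] by simp
      then obtain z where "(adj ^^ m) x z" "adj z y" by auto
      then show ?thesis using gdist_le[of m adj x z] by (force simp: nbrs_def)
    qed auto
  qed
  have "V x (real (Suc m)) \<le> vol wt (\<Union>y\<in>B x (real m). N y)"
    by (rule vol_mono[OF _ sub]) auto
  also have "\<dots> \<le> (\<Sum>y\<in>B x (real m). vol wt (N y))"
    by (rule vol_UN_le) auto
  also have "\<dots> \<le> (\<Sum>y\<in>B x (real m). (1 + Cc\<^sup>2) * wt y)"
    by (rule sum_mono) (rule vol_nbrs)
  also have "\<dots> = (1 + Cc\<^sup>2) * V x (real m)" by (simp add: vol_def sum_distrib_left)
  also have "\<dots> \<le> (1 + Cc\<^sup>2) * ((1 + Cc\<^sup>2) ^ m * wt x)"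
    by (rule mult_left_mono[OF Suc]) simp
  finally show ?case by simp
qed

text \<open>The total mass of the heat kernel on a ball is at most 1, so the lower heat kernel bound
  bounds the volume of the ball.\<close>

lemma V_exp_c2:
  assumes "0 \<le> r" "r \<le> real n"
  shows "V x r \<le> (1 / c1) * exp (r\<^sup>2 / (c2 * n)) * V x (sqrt n)"
proof -
  have Vp: "V x (sqrt n) > 0" by (rule V_pos) simp
  define e where "e = c1 / V x (sqrt n) * exp (- r\<^sup>2 / (c2 * n))"
  have "V x r * e = (\<Sum>y\<in>B x r. wt y * e)" by (simp add: vol_def sum_distrib_right)
  also have "\<dots> \<le> (\<Sum>y\<in>B x r. q UNIV n x y)"
  proof (rule sum_mono)
    fix y assume y: "y \<in> B x r"
    have "(real (d x y))\<^sup>2 \<le> r\<^sup>2" using y by (intro power_mono) auto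
    then have "(real (d x y))\<^sup>2 / (c2 * n) \<le> r\<^sup>2 / (c2 * n)"
      using c_pos by (intro divide_right_mono) auto
    then have "wt y * e \<le> wt y * (c1 / V x (sqrt n) * exp (- (real (d x y))\<^sup>2 / (c2 * n)))"
      unfolding e_def using c_pos Vp by (intro mult_left_mono) auto
    also have "\<dots> \<le> q UNIV n x y" by (rule q_lower) (use y assms in simp)
    finally show "wt y * e \<le> q UNIV n x y" .
  qed
  also have "\<dots> = killed UNIV n (indicator (B x r)) x"
    by (subst killed_expand_finite[where F = "B x r"]) (auto simp: indicator_def)
  also have "\<dots> \<le> 1" by (rule killed_le_const) (auto simp: indicator_def)
  finally have "V x r * e \<le> 1" .
  then show ?thesis using Vp c_pos by (simp add: e_def exp_minus field_simps)
qed

lemma doubling: "\<exists>D\<ge>1. \<forall>x r. 0 \<le> r \<longrightarrow> V x (2 * r) \<le> D * V x r"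
proof -
  define D where "D = max ((1 + Cc\<^sup>2) ^ 6) ((1 / c1) * exp (9 / c2))"
  have D1: "D \<ge> 1" unfolding D_def by (simp add: le_max_iff_disj)
  have "V x (2 * r) \<le> D * V x r" if r: "0 \<le> r" for x r
  proof (cases "r < 3")
    case True
    have "V x (2 * r) \<le> V x (real 6)" by (rule V_mono) (use True in simp)
    also have "\<dots> \<le> (1 + Cc\<^sup>2) ^ 6 * wt x" by (rule V_nat)
    also have "\<dots> \<le> D * V x r"
      by (rule mult_mono) (use wt_le_V[OF r] D1 in \<open>auto simp: D_def\<close>)
    finally show ?thesis .
  next
    case False
    define n where "n = nat \<lfloor>r\<^sup>2\<rfloor>"
    have r9: "9 \<le> r\<^sup>2" using power_mono[of 3 r 2] False by simp
    have n: "real n \<le> r\<^sup>2" "r\<^sup>2 < real n + 1" unfolding n_def by auto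
    have n9: "9 \<le> n" using r9 unfolding n_def by linarith
    have sn: "sqrt n \<le> r" using n(1) r by (simp add: real_le_lsqrt)
    have "2 * r \<le> 3 * sqrt n"
    proof (rule power2_le_imp_le)
      show "(2 * r)\<^sup>2 \<le> (3 * sqrt n)\<^sup>2" using n n9 by (simp add: power_mult_distrib)
    qed simp
    also have "3 * sqrt n \<le> sqrt n * sqrt n"
      by (rule mult_right_mono) (use n9 in \<open>auto simp: real_le_rsqrt\<close>)
    finally have le: "2 * r \<le> real n" by simp
    have "V x (2 * r) \<le> V x (3 * sqrt n)" by (rule V_mono) fact
    also have "\<dots> \<le> (1 / c1) * exp ((3 * sqrt n)\<^sup>2 / (c2 * n)) * V x (sqrt n)"
      by (rule V_exp_c2) (use \<open>3 * sqrt n \<le> sqrt n * sqrt n\<close> in auto)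
    also have "(3 * sqrt n)\<^sup>2 / (c2 * n) = 9 / c2" using n9 by (simp add: power_mult_distrib)
    also have "(1 / c1) * exp (9 / c2) * V x (sqrt n) \<le> D * V x r"
      by (intro mult_mono V_mono sn) (use D1 in \<open>auto simp: D_def\<close>)
    finally show ?thesis .
  qed
  with D1 show ?thesis by blast
qed

lemma doubling_mult: "\<exists>D\<ge>1. \<forall>x r. 0 \<le> r \<longrightarrow> V x (l * r) \<le> D * V x r"
proof -
  obtain D where D: "D \<ge> 1" "\<And>x r. 0 \<le> r \<Longrightarrow> V x (2 * r) \<le> D * V x r" using doubling by blast
  obtain k :: nat where k: "l \<le> 2 ^ k" using real_arch_pow[of 2 l] by (meson less_imp_le one_less_numeral_iff semiring_norm(76))
  have pow: "V x (2 ^ j * r) \<le> D ^ j * V x r" if "0 \<le> r" for x r j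
  proof (induction j)
    case (Suc j)
    have "V x (2 ^ Suc j * r) \<le> D * V x (2 ^ j * r)" using D(2)[of "2 ^ j * r" x] that by (simp add: mult_ac)
    also have "\<dots> \<le> D * (D ^ j * V x r)" by (rule mult_left_mono[OF Suc]) (use D in auto)
    finally show ?case by simp
  qed simp
  have "V x (l * r) \<le> D ^ k * V x r" if "0 \<le> r" for x r
    using V_mono[of "l * r" "2 ^ k * r" x] pow[OF that, of x k] mult_right_mono[OF k that] by linarith
  moreover have "D ^ k \<ge> 1" using D by simp
  ultimately show ?thesis by blast
qed

lemma doubling_translate:
  "\<exists>D\<ge>1. \<forall>x y r. 0 \<le> r \<longrightarrow> real (d x y) \<le> l * r \<longrightarrow> V x (l * r) \<le> D * V y r"
proof -
  obtain D where D: "D \<ge> 1" "\<And>x r. 0 \<le> r \<Longrightarrow> V x ((2 * l) * r) \<le> D * V x r"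
    using doubling_mult by blast
  have "V x (l * r) \<le> D * V y r" if "0 \<le> r" "real (d x y) \<le> l * r" for x y r
  proof -
    have "V x (l * r) \<le> V y (2 * l * r)"
      by (rule V_translate) (use that d_commute[of x y] in simp)
    also have "\<dots> \<le> D * V y r" by (rule D(2)[OF that(1)])
    finally show ?thesis .
  qed
  with D(1) show ?thesis by blast
qed

lemma V_exp:
  assumes "\<kappa> > 0"
  shows "\<exists>C\<ge>1. \<forall>x n r. n \<ge> 1 \<longrightarrow> 0 \<le> r \<longrightarrow> r \<le> real n \<longrightarrow>
    V x r \<le> C * exp (\<kappa> * r\<^sup>2 / n) * V x (sqrt n)"
proof -
  obtain b :: nat where b: "1 / (c2 * \<kappa>) < b" using reals_Archimedean2 by blast
  have b0: "b > 0" using b assms c_pos by (smt (verit) divide_pos_pos mult_pos_pos of_nat_0_less_iff)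
  obtain D where D: "D \<ge> 1" "\<And>x r. 0 \<le> r \<Longrightarrow> V x (sqrt b * r) \<le> D * V x r"
    using doubling_mult by blast
  have "V x r \<le> max 1 (D / c1) * exp (\<kappa> * r\<^sup>2 / n) * V x (sqrt n)"
    if "n \<ge> 1" "0 \<le> r" "r \<le> real n" for x n r
  proof -
    have "V x r \<le> (1 / c1) * exp (r\<^sup>2 / (c2 * real (b * n))) * V x (sqrt (real (b * n)))"
    proof (rule V_exp_c2)
      have "n \<le> b * n" using b0 by simp
      then have "real n \<le> real (b * n)" unfolding of_nat_le_iff .
      then show "r \<le> real (b * n)" using that by linarith
    qed fact
    also have "\<dots> \<le> (1 / c1) * exp (\<kappa> * r\<^sup>2 / n) * (D * V x (sqrt n))"
    proof (intro mult_mono)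
      have "1 / (c2 * b) \<le> \<kappa>" using b b0 c_pos assms by (simp add: field_simps)
      then have "1 / (c2 * b) * (r\<^sup>2 / n) \<le> \<kappa> * (r\<^sup>2 / n)" by (rule mult_right_mono) simp
      then show "exp (r\<^sup>2 / (c2 * real (b * n))) \<le> exp (\<kappa> * r\<^sup>2 / n)" by (simp add: mult_ac)
      show "V x (sqrt (real (b * n))) \<le> D * V x (sqrt n)"
        using D(2)[of "sqrt n" x] by (simp add: real_sqrt_mult)
    qed (use c_pos in auto)
    also have "\<dots> = (D / c1) * (exp (\<kappa> * r\<^sup>2 / n) * V x (sqrt n))" by simp
    also have "\<dots> \<le> max 1 (D / c1) * (exp (\<kappa> * r\<^sup>2 / n) * V x (sqrt n))"
      by (rule mult_right_mono) auto
    finally show ?thesis by (simp add: mult.assoc)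
  qed
  then show ?thesis by (intro exI[of _ "max 1 (D / c1)"]) auto
qed

text \<open>Half of the Gaussian factor of \<open>p(n,x,y)\<close> is absorbed by \<open>p(bn,x,y)\<close> for large \<open>b\<close>,
  which has total mass 1.\<close>

lemma gaussian_tail:
  "\<exists>C\<ge>1. \<forall>x n R. n \<ge> 1 \<longrightarrow> 0 \<le> R \<longrightarrow>
    killed UNIV n (indicator {y. R \<le> real (d x y)}) x \<le> C * exp (- R\<^sup>2 / (2 * c4 * n))"
proof -
  obtain b :: nat where b: "2 * c4 / c2 < b" using reals_Archimedean2 by blast
  have b0: "b > 0" using b c_pos by (smt (verit) divide_pos_pos of_nat_0_less_iff)
  obtain D where D: "D \<ge> 1" "\<And>x r. 0 \<le> r \<Longrightarrow> V x (sqrt b * r) \<le> D * V x r"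
    using doubling_mult by blast
  define C where "C = c3 / c1 * D"
  have C0: "C > 0" using c_pos D by (simp add: C_def)
  have main: "killed UNIV n (indicator {y. R \<le> real (d x y)}) x \<le> C * exp (- R\<^sup>2 / (2 * c4 * n))"
    if n: "n \<ge> 1" and R: "0 \<le> R" for x n R
  proof -
    define e where "e = exp (- R\<^sup>2 / (2 * c4 * n))"
    have pt: "q UNIV n x y * indicator {y. R \<le> real (d x y)} y \<le> C * e * q UNIV (b * n) x y"
      if y: "y \<in> B x n" for y
    proof (cases "R \<le> real (d x y)")
      case True
      define t where "t = (real (d x y))\<^sup>2"
      have Rt: "R\<^sup>2 \<le> t" unfolding t_def using True R by (intro power_mono) auto
      have "- t / (c4 * n) = - t / (2 * c4 * n) + - t / (2 * c4 * n)"
        using n c_pos by (simp add: field_simps)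
      then have "exp (- t / (c4 * n)) = exp (- t / (2 * c4 * n)) * exp (- t / (2 * c4 * n))"
        by (metis exp_add)
      also have "\<dots> \<le> e * exp (- t / (c2 * (b * n)))"
      proof (rule mult_mono)
        show "exp (- t / (2 * c4 * n)) \<le> e" unfolding e_def using Rt c_pos n
          by (simp add: divide_right_mono)
        have "2 * c4 * n \<le> c2 * (b * n)" using b c_pos n by (simp add: field_simps)
        then have "t / (c2 * (b * n)) \<le> t / (2 * c4 * n)"
          using c_pos n b0 by (intro divide_left_mono) (auto simp: t_def)
        then show "exp (- t / (2 * c4 * n)) \<le> exp (- t / (c2 * (b * n)))" by simp
      qed (auto simp: e_def)
      finally have ex: "exp (- t / (c4 * n)) \<le> e * exp (- t / (c2 * (b * n)))" .
      have Vp: "V x (sqrt n) > 0" "V x (sqrt (b * n)) > 0" by (auto intro!: V_pos)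
      have VD: "V x (sqrt (b * n)) \<le> D * V x (sqrt n)"
        using D(2)[of "sqrt n" x] by (simp add: real_sqrt_mult)
      have dV: "1 / V x (sqrt n) \<le> D / V x (sqrt (b * n))"
        using Vp VD by (simp add: field_simps)
      have "q UNIV n x y \<le> wt y * (c3 / V x (sqrt n) * exp (- t / (c4 * n)))"
        unfolding t_def by (rule q_upper)
      also have "\<dots> = wt y * c3 * (1 / V x (sqrt n) * exp (- t / (c4 * n)))" by simp
      also have "\<dots> \<le> wt y * c3 * (D / V x (sqrt (b * n)) * (e * exp (- t / (c2 * (b * n)))))"
        by (intro mult_left_mono mult_mono dV ex) (use c_pos D in auto)
      also have "\<dots> = C * e * (wt y * (c1 / V x (sqrt (b * n)) * exp (- t / (c2 * (b * n)))))"
        using c_pos by (simp add: C_def)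
      also have "\<dots> \<le> C * e * q UNIV (b * n) x y"
      proof (rule mult_left_mono)
        have "n \<le> b * n" using b0 by simp
        then have "d x y \<le> b * n" using y unfolding mem_ball of_nat_le_iff by linarith
        from q_lower[OF this]
        show "wt y * (c1 / V x (sqrt (b * n)) * exp (- t / (c2 * (b * n)))) \<le> q UNIV (b * n) x y"
          unfolding t_def by simp
      qed (use C0 in \<open>auto simp: e_def\<close>)
      finally show ?thesis using True by simp
    next
      case False
      then show ?thesis using C0 by (simp add: e_def)
    qed
    have "killed UNIV n (indicator {y. R \<le> real (d x y)}) x
        = (\<Sum>y\<in>B x n. q UNIV n x y * indicator {y. R \<le> real (d x y)} y)"
      by (rule killed_expand) simp
    also have "\<dots> \<le> (\<Sum>y\<in>B x n. C * e * q UNIV (b * n) x y)" by (rule sum_mono) (rule pt)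
    also have "\<dots> = C * e * (\<Sum>y\<in>B x n. q UNIV (b * n) x y)" by (simp add: sum_distrib_left)
    also have "(\<Sum>y\<in>B x n. q UNIV (b * n) x y) = killed UNIV (b * n) (indicator (B x n)) x"
      by (subst killed_expand_finite[where F = "B x n"]) (auto simp: indicator_def)
    also have "C * e * \<dots> \<le> C * e * 1"
      by (intro mult_left_mono killed_le_const) (use C0 in \<open>auto simp: indicator_def e_def\<close>)
    finally show ?thesis by (simp add: e_def)
  qed
  have "killed UNIV n (indicator {y. R \<le> real (d x y)}) x \<le> max 1 C * exp (- R\<^sup>2 / (2 * c4 * n))"
    if n: "n \<ge> 1" and R: "0 \<le> R" for x n R
    by (rule order_trans[OF main[OF that] mult_right_mono]) auto
  then show ?thesis by (intro exI[of _ "max 1 C"]) auto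
qed

lemma exit_bound:
  "\<exists>C c. C \<ge> 1 \<and> c > 0 \<and> (\<forall>x n R. n \<ge> 1 \<longrightarrow> 0 \<le> R \<longrightarrow>
     hit (- B x R) n x \<le> C * exp (- c * R\<^sup>2 / n))"
proof -
  obtain C where C: "C \<ge> 1" and tail: "\<And>x n R. n \<ge> 1 \<Longrightarrow> 0 \<le> R \<Longrightarrow>
    killed UNIV n (indicator {y. R \<le> real (d x y)}) x \<le> C * exp (- R\<^sup>2 / (2 * c4 * n))"
    using gaussian_tail by blast
  define M where "M = sqrt (2 * c4 * ln (2 * C))"
  have M2: "M\<^sup>2 = 2 * c4 * ln (2 * C)" unfolding M_def using C c_pos by simp
  have M0: "M \<ge> 0" unfolding M_def using C c_pos by simp
  have Mhalf: "C * exp (- M\<^sup>2 / (2 * c4)) = 1 / 2"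
    unfolding M2 using C c_pos by (simp add: exp_minus)
  define C' where "C' = max (2 * C) (exp (M\<^sup>2 / (2 * c4)))"
  have "hit (- B x R) n x \<le> C' * exp (- (1 / (8 * c4)) * R\<^sup>2 / n)" if n: "n \<ge> 1" and R: "0 \<le> R" for x n R
  proof (cases "2 * M * sqrt n \<le> R")
    case True
    define f where "f = (indicator {y. R / 2 \<le> real (d x y)} :: 'a \<Rightarrow> real)"
    have R2: "M\<^sup>2 * n \<le> (R / 2)\<^sup>2"
      using power_mono[of "M * sqrt n" "R / 2" 2] True M0 by (simp add: power_mult_distrib)
    have ge: "1 / 2 \<le> killed UNIV m f z" if m: "m \<le> n" and z: "z \<notin> B x R" for m z
    proof (cases "m = 0")
      case True
      then show ?thesis using z R by (simp add: f_def)
    next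
      case False
      define g where "g = (indicator {y. R / 2 \<le> real (d z y)} :: 'a \<Rightarrow> real)"
      have "killed UNIV m g z \<le> C * exp (- (R / 2)\<^sup>2 / (2 * c4 * m))"
        unfolding g_def by (rule tail) (use False R in auto)
      also have "\<dots> \<le> C * exp (- M\<^sup>2 / (2 * c4))"
      proof -
        have "M\<^sup>2 * m \<le> (R / 2)\<^sup>2"
          using R2 mult_left_mono[of "real m" "real n" "M\<^sup>2"] m by simp
        then have "M\<^sup>2 / (2 * c4) \<le> (R / 2)\<^sup>2 / (2 * c4 * m)"
          using False c_pos by (simp add: field_simps)
        then show ?thesis using C by simp
      qed
      finally have gle: "killed UNIV m g z \<le> 1 / 2" using Mhalf by linarith
      have "1 = killed UNIV m (\<lambda>_. 1) z" by simp
      also have "\<dots> \<le> killed UNIV m (\<lambda>y. f y + g y) z"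
      proof (rule killed_mono)
        fix y
        have "real (d x z) \<le> real (d x y) + real (d z y)" using d_triangle[of x z y] d_commute[of y z] by simp
        then show "1 \<le> f y + g y" using z by (auto simp: f_def g_def indicator_def)
      qed
      also have "\<dots> = killed UNIV m f z + killed UNIV m g z" by (rule killed_add)
      finally show ?thesis using gle by simp
    qed
    have "1 / 2 * hit (- B x R) n x \<le> killed UNIV n f x"
      by (rule exit_le_killed) (use ge in \<open>auto simp: f_def\<close>)
    also have "\<dots> \<le> C * exp (- (R / 2)\<^sup>2 / (2 * c4 * n))"
      unfolding f_def by (rule tail) (use n R in auto)
    also have "- (R / 2)\<^sup>2 / (2 * c4 * n) = - (1 / (8 * c4)) * R\<^sup>2 / n"
      by (simp add: power2_eq_square)
    finally have "hit (- B x R) n x \<le> (2 * C) * exp (- (1 / (8 * c4)) * R\<^sup>2 / n)" by simp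
    also have "\<dots> \<le> C' * exp (- (1 / (8 * c4)) * R\<^sup>2 / n)"
      by (rule mult_right_mono) (auto simp: C'_def)
    finally show ?thesis .
  next
    case False
    have "R\<^sup>2 \<le> (2 * M * sqrt n)\<^sup>2" by (rule power_mono) (use False R in auto)
    also have "\<dots> = 4 * M\<^sup>2 * n" by (simp add: power_mult_distrib)
    finally have "R\<^sup>2 / (8 * c4 * n) \<le> M\<^sup>2 / (2 * c4)"
      using c_pos n by (simp add: field_simps)
    then have "0 \<le> M\<^sup>2 / (2 * c4) + - (1 / (8 * c4)) * R\<^sup>2 / n" by simp
    then have "1 \<le> exp (M\<^sup>2 / (2 * c4) + - (1 / (8 * c4)) * R\<^sup>2 / n)" by simp
    also have "\<dots> = exp (M\<^sup>2 / (2 * c4)) * exp (- (1 / (8 * c4)) * R\<^sup>2 / n)" by (rule exp_add)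
    also have "\<dots> \<le> C' * exp (- (1 / (8 * c4)) * R\<^sup>2 / n)"
      by (rule mult_right_mono) (auto simp: C'_def)
    finally show ?thesis using hit_le_1[of "- B x R" n x] by linarith
  qed
  moreover have "C' \<ge> 1" using C by (simp add: C'_def)
  moreover have "1 / (8 * c4) > 0" using c_pos by simp
  ultimately show ?thesis by blast
qed

end

section \<open>Inner uniform subgraphs\<close>

locale inner_unif = harnack adj mu wt Cc c1 c2 c3 c4
  for adj :: "'a \<Rightarrow> 'a \<Rightarrow> bool" and mu :: "'a \<Rightarrow> 'a \<Rightarrow> real" and wt :: "'a \<Rightarrow> real"
    and Cc c1 c2 c3 c4 :: real +
  fixes K :: "'a set" and cu CU :: real
  assumes infinite_G: "infinite (- K)" and cu_pos: "cu > 0" and CU_pos: "CU > 0"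
    and inner_uniform_walk: "\<And>x y. x \<notin> K \<Longrightarrow> y \<notin> K \<Longrightarrow>
      \<exists>xs. walk (adjG K adj) xs \<and> hd xs = x \<and> last xs = y \<and>
         real (length xs - 1) \<le> CU * real (dG K adj x y) \<and>
         (\<forall>j < length xs. \<forall>z\<in>outer_bdry K adj.
            cu * (1 + real (min j (length xs - 1 - j))) \<le> real (gdist adj (xs ! j) z))"
begin

abbreviation "dI \<equiv> dG K adj"
abbreviation "adjI \<equiv> adjG K adj"
definition deep :: "real \<Rightarrow> 'a \<Rightarrow> bool" where
  "deep s x \<longleftrightarrow> (\<forall>k\<in>K. s \<le> real (d x k))"

lemma adjI_conn:
  assumes "x \<notin> K" "y \<notin> K"
  shows "adjI\<^sup>*\<^sup>* x y"
  using inner_uniform_walk[OF assms] walk_relpowp_ends[of adjI]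
  by (metis relpowp_imp_rtranclp)

lemma adjI_relpowp_notin: "(adjI ^^ n) x y \<Longrightarrow> x \<notin> K \<Longrightarrow> y \<notin> K"
  by (cases n) (auto simp: adjG_def)

lemma dI_triangle: "x \<notin> K \<Longrightarrow> y \<notin> K \<Longrightarrow> z \<notin> K \<Longrightarrow> dI x z \<le> dI x y + dI y z"
  unfolding dG_def by (intro gdist_triangle adjI_conn)

lemma dI_commute: "dI x y = dI y x"
  unfolding dG_def using gdist_commute[of adjI] adj_sym by (auto simp: adjG_def)

lemma dI_refl [simp]: "dI x x = 0"
  unfolding dG_def by simp

lemma dI_le_relpowp: "(adjI ^^ n) x y \<Longrightarrow> dI x y \<le> n"
  unfolding dG_def by (rule gdist_le)

lemma dI_adj: "adjI x y \<Longrightarrow> dI x y \<le> 1"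
  using dI_le_relpowp[of 1 x y] by (simp only: relpowp_1)

lemma d_le_dI: "x \<notin> K \<Longrightarrow> y \<notin> K \<Longrightarrow> d x y \<le> dI x y"
proof -
  assume "x \<notin> K" "y \<notin> K"
  then have "(adjI ^^ dI x y) x y" unfolding dG_def by (intro relpowp_gdist adjI_conn)
  then have "(adj ^^ dI x y) x y" by (rule relpowp_mono[rotated]) (simp add: adjG_def)
  then show ?thesis by (rule gdist_le)
qed

lemma ballG_subset: "x \<notin> K \<Longrightarrow> ballG K adj x r \<subseteq> B x r"
  using d_le_dI by (fastforce simp: ballG_def)

lemma finite_ballG: "x \<notin> K \<Longrightarrow> finite (ballG K adj x r)"
  using ballG_subset finite_ball by (rule finite_subset)

lemma VG_le_V: "x \<notin> K \<Longrightarrow> VG K adj wt x r \<le> V x r"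
  unfolding VG_def by (intro vol_mono ballG_subset) auto

lemma VG_pos: "x \<notin> K \<Longrightarrow> r \<ge> 0 \<Longrightarrow> VG K adj wt x r > 0"
proof -
  assume "x \<notin> K" "r \<ge> 0"
  then have "wt x \<le> VG K adj wt x r"
    unfolding VG_def by (intro wt_le_vol finite_ballG) (auto simp: ballG_def)
  then show ?thesis using wt_pos[of x] by linarith
qed

lemma deep_mono: "deep s x \<Longrightarrow> t \<le> s \<Longrightarrow> deep t x"
  unfolding deep_def by force

lemma deep_translate: "deep s x \<Longrightarrow> t + real (d x y) \<le> s \<Longrightarrow> deep t y"
  unfolding deep_def
proof
  fix k assume "\<forall>k\<in>K. s \<le> real (d x k)" "t + real (d x y) \<le> s" "k \<in> K"
  with d_triangle[of x k y] show "t \<le> real (d y k)" by force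
qed

lemma deep_notin: "deep s x \<Longrightarrow> s > 0 \<Longrightarrow> x \<notin> K"
  unfolding deep_def by force

lemma deep_bdry:
  assumes "x \<notin> K" "\<forall>z\<in>outer_bdry K adj. s \<le> real (d x z)"
  shows "deep s x"
  unfolding deep_def
proof
  fix k assume k: "k \<in> K"
  obtain f where f: "f 0 = x" "f (d x k) = k" "\<forall>i<d x k. adj (f i) (f (Suc i))"
    using relpowp_gdist[OF adj_conn, of x k] unfolding relpowp_fun_conv by blast
  define i where "i = (LEAST i. f i \<in> K)"
  have iK: "f i \<in> K" unfolding i_def by (rule LeastI[of _ "d x k"]) (use f k in simp)
  have ile: "i \<le> d x k" unfolding i_def by (rule Least_le) (use f k in simp)
  obtain j where j: "i = Suc j" using iK f(1) assms(1) by (cases i) auto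
  have jK: "f j \<notin> K" using not_less_Least[of j "\<lambda>i. f i \<in> K"] j by (simp add: i_def)
  have "adj (f j) (f i)" using f(3) ile j by auto
  then have "f i \<in> outer_bdry K adj"
    unfolding outer_bdry_def using iK jK adj_sym by blast
  then have "s \<le> real (d x (f i))" using assms(2) by blast
  also have "(adj ^^ i) x (f i)"
    unfolding relpowp_fun_conv by (rule exI[of _ f]) (use f ile in auto)
  then have "real (d x (f i)) \<le> real i" using gdist_le by (metis of_nat_le_iff)
  finally show "s \<le> real (d x k)" using ile by linarith
qed

lemma far_point:
  assumes "x \<notin> K"
  shows "\<exists>y. y \<notin> K \<and> j \<le> dI x y"
proof (rule ccontr)
  assume "\<not> ?thesis"
  then have "- K \<subseteq> B x (real j)" using d_le_dI[OF assms] by (force simp: not_le)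
  then show False using infinite_G finite_subset finite_ball by blast
qed

lemma interior_point:
  assumes "x \<notin> K"
  shows "\<exists>w. w \<notin> K \<and> dI x w \<le> j \<and> deep (cu * (1 + real j)) w"
proof -
  obtain y where y: "y \<notin> K" "2 * j \<le> dI x y" using far_point[OF assms] by blast
  obtain xs where xs: "walk adjI xs" "hd xs = x" "last xs = y"
    and deep: "\<forall>i < length xs. \<forall>z\<in>outer_bdry K adj.
            cu * (1 + real (min i (length xs - 1 - i))) \<le> real (d (xs ! i) z)"
    using inner_uniform_walk[OF assms y(1)] by blast
  have ne: "xs \<noteq> []" using xs(1) by (simp add: walk_def)
  have "dI x y \<le> length xs - 1"
    using walk_relpowp_ends[OF xs(1)] xs dI_le_relpowp by simp
  then have len: "2 * j \<le> length xs - 1" using y by linarith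
  have jl: "j < length xs" using len ne by (cases xs) auto
  have pw: "(adjI ^^ j) x (xs ! j)"
    using walk_nth_relpowp[OF xs(1), of 0 j] jl ne xs(2) by (simp add: hd_conv_nth)
  have wK: "xs ! j \<notin> K" using adjI_relpowp_notin[OF pw assms] .
  have "min j (length xs - 1 - j) = j" using len by linarith
  then have "deep (cu * (1 + real j)) (xs ! j)"
    using deep_bdry[OF wK] deep jl by metis
  with wK dI_le_relpowp[OF pw] show ?thesis by blast
qed

lemma deep_ball:
  assumes "deep s w" "real (d w v) < s"
  shows "v \<notin> K \<and> dI w v \<le> d w v"
proof -
  obtain f where f: "f 0 = w" "f (d w v) = v" "\<forall>i<d w v. adj (f i) (f (Suc i))"
    using relpowp_gdist[OF adj_conn, of w v] unfolding relpowp_fun_conv by blast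
  have nK: "f i \<notin> K" if "i \<le> d w v" for i
  proof
    assume "f i \<in> K"
    then have "s \<le> real (d w (f i))" using assms(1) by (simp add: deep_def)
    moreover have "(adj ^^ i) w (f i)"
      unfolding relpowp_fun_conv by (rule exI[of _ f]) (use f that in auto)
    then have "d w (f i) \<le> i" by (rule gdist_le)
    ultimately show False using assms(2) that by linarith
  qed
  have "(adjI ^^ d w v) w v"
    unfolding relpowp_fun_conv by (rule exI[of _ f]) (use f nK in \<open>auto simp: adjG_def\<close>)
  then show ?thesis using dI_le_relpowp nK[of "d w v"] f(2) by auto
qed

lemma VG_ge: "\<exists>c>0. \<forall>x r. x \<notin> K \<longrightarrow> 0 \<le> r \<longrightarrow> c * V x r \<le> VG K adj wt x r"
proof -
  define l where "l = min (cu / 2) (1 / 2)"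
  have l: "0 < l" "l \<le> cu / 2" "l \<le> 1 / 2" using cu_pos by (auto simp: l_def)
  obtain D where D: "D \<ge> 1"
    "\<And>x y r. 0 \<le> r \<Longrightarrow> real (d x y) \<le> (1 / l) * r \<Longrightarrow> V x ((1 / l) * r) \<le> D * V y r"
    using doubling_translate[of "1 / l"] by blast
  have "1 / D * V x r \<le> VG K adj wt x r" if x: "x \<notin> K" and r: "0 \<le> r" for x r
  proof -
    define j where "j = nat \<lfloor>r / 2\<rfloor>"
    have j: "real j \<le> r / 2" "r / 2 < 1 + real j" unfolding j_def using r by linarith+
    obtain w where w: "w \<notin> K" "dI x w \<le> j" "deep (cu * (1 + real j)) w"
      using interior_point[OF x] by blast
    have sub: "B w (l * r) \<subseteq> ballG K adj x r"
    proof
      fix v assume v: "v \<in> B w (l * r)"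
      have "l * r \<le> cu / 2 * r" using l r by (intro mult_right_mono) auto
      also have "\<dots> < cu * (1 + real j)" using j cu_pos by simp
      finally have "real (d w v) < cu * (1 + real j)" using v by simp
      then have v2: "v \<notin> K" "dI w v \<le> d w v" using deep_ball[OF w(3)] by auto
      have "l * r \<le> 1 / 2 * r" using l r by (intro mult_right_mono) auto
      then have "real (dI w v) \<le> r / 2" using v v2 by simp
      moreover have "dI x v \<le> dI x w + dI w v" by (rule dI_triangle) (use x w v2 in auto)
      ultimately have "real (dI x v) \<le> r" using w(2) j by linarith
      then show "v \<in> ballG K adj x r" using v2 by (simp add: ballG_def)
    qed
    have "V x r = V x ((1 / l) * (l * r))" using l by simp
    also have "\<dots> \<le> D * V w (l * r)"
    proof (rule D(2))
      have "d x w \<le> dI x w" by (rule d_le_dI) (use x w in auto)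
      then show "real (d x w) \<le> 1 / l * (l * r)" using w j l by simp
    qed (use l r in simp)
    also have "\<dots> \<le> D * VG K adj wt x r"
      unfolding VG_def by (intro mult_left_mono vol_mono finite_ballG x sub) (use D in auto)
    finally show ?thesis using D(1) by (simp add: field_simps)
  qed
  moreover have "1 / D > 0" using D by simp
  ultimately show ?thesis by blast
qed

lemma dI_intermediate:
  assumes "E\<^sup>*\<^sup>* x w" "x \<notin> K" "\<And>u v. E u v \<Longrightarrow> adjI u v"
  shows "w \<notin> K \<and> (\<forall>t\<le>dI x w. \<exists>z. E\<^sup>*\<^sup>* x z \<and> dI x z = t)"
  using assms(1)
proof (induction rule: rtranclp_induct)
  case base
  then show ?case using assms(2) by auto
next
  case (step y z)
  have yz: "adjI y z" using step assms(3) by blast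
  then have K: "y \<notin> K" "z \<notin> K" by (auto simp: adjG_def)
  have "dI x z \<le> dI x y + dI y z" by (rule dI_triangle) (use K assms in auto)
  with dI_adj[OF yz] have le: "dI x z \<le> Suc (dI x y)" by linarith
  have "\<exists>v. E\<^sup>*\<^sup>* x v \<and> dI x v = t" if "t \<le> dI x z" for t
  proof (cases "t \<le> dI x y")
    case False
    then have "t = dI x z" using that le by linarith
    moreover have "E\<^sup>*\<^sup>* x z" using step(1,2) by (rule rtranclp.rtrancl_into_rtrancl)
    ultimately show ?thesis by blast
  qed (use step in blast)
  then show ?case using K by blast
qed

text \<open>Packing: points of a connected piece of \<open>\<Gamma> \<inter> B(x,R)\<close> at inner distances \<open>t, 2t, 3t, \<dots>\<close>
  from \<open>x\<close> carry disjoint inner balls of radius \<open>R\<close>, each of volume comparable to \<open>V(x,2R)\<close>.\<close>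

lemma component_diameter:
  "\<exists>C\<ge>1. \<forall>x R w. x \<notin> K \<longrightarrow> 0 \<le> R \<longrightarrow> (\<lambda>u v. adjI u v \<and> v \<in> B x R)\<^sup>*\<^sup>* x w \<longrightarrow>
     real (dI x w) \<le> C * R"
proof -
  obtain c where c: "c > 0" "\<And>x r. x \<notin> K \<Longrightarrow> 0 \<le> r \<Longrightarrow> c * V x r \<le> VG K adj wt x r"
    using VG_ge by blast
  obtain D where D: "D \<ge> 1"
    "\<And>x y r. 0 \<le> r \<Longrightarrow> real (d x y) \<le> 2 * r \<Longrightarrow> V x (2 * r) \<le> D * V y r"
    using doubling_translate[of 2] by blast
  obtain M :: nat where M: "D / c < M" using reals_Archimedean2 by blast
  have M0: "M > 0" using M D c by (smt (verit) divide_pos_pos of_nat_0_less_iff)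
  have "real (dI x w) \<le> 3 * real M * R"
    if x: "x \<notin> K" and R: "0 \<le> R" and reach: "(\<lambda>u v. adjI u v \<and> v \<in> B x R)\<^sup>*\<^sup>* x w" for x R w
  proof (cases "R < 1")
    case True
    have sing: "B x R \<subseteq> {x}"
    proof
      fix z assume "z \<in> B x R"
      then have "d x z = 0" using True unfolding mem_ball by linarith
      then show "z \<in> {x}" by simp
    qed
    have "z = x" if "(\<lambda>u v. adjI u v \<and> v \<in> B x R)\<^sup>*\<^sup>* x z" for z
      using that by (induction rule: rtranclp_induct) (use sing in blast)+
    then have "w = x" using reach by blast
    then show ?thesis using R by simp
  next
    case False
    let ?E = "\<lambda>u v. adjI u v \<and> v \<in> B x R"
    show ?thesis
    proof (rule ccontr)
      assume "\<not> ?thesis"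
      then have big: "3 * real M * R < real (dI x w)" by simp
      define t where "t = nat \<lfloor>2 * R\<rfloor> + 1"
      have t: "2 * R < real t" "real t \<le> 3 * R" unfolding t_def using False by linarith+
      have iv: "\<forall>s\<le>dI x w. \<exists>z. ?E\<^sup>*\<^sup>* x z \<and> dI x z = s"
        using dI_intermediate[OF reach x] by blast
      have "\<exists>z. ?E\<^sup>*\<^sup>* x z \<and> dI x z = i * t" if "i < M" for i
      proof -
        have "real (i * t) \<le> real M * (3 * R)"
          unfolding of_nat_mult by (rule mult_mono) (use that t R in auto)
        then have "real (i * t) \<le> real (dI x w)" using big by simp
        then have "i * t \<le> dI x w" unfolding of_nat_le_iff .
        then show ?thesis using iv by blast
      qed
      then obtain z where z: "\<And>i. i < M \<Longrightarrow> ?E\<^sup>*\<^sup>* x (z i)" "\<And>i. i < M \<Longrightarrow> dI x (z i) = i * t"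
        by metis
      have zK: "z i \<notin> K" if "i < M" for i
        using dI_intermediate[OF z(1)[OF that] x] by blast
      have zB: "z i \<in> B x R" if "i < M" for i
        using z(1)[OF that] R by (induction rule: rtranclp_induct) auto
      let ?b = "\<lambda>i. ballG K adj (z i) R"
      have disj: "?b i \<inter> ?b j = {}" if ij: "i < M" "j < M" "i < j" for i j
      proof (rule ccontr)
        assume "?b i \<inter> ?b j \<noteq> {}"
        then obtain v where v: "v \<notin> K" "real (dI (z i) v) \<le> R" "real (dI (z j) v) \<le> R"
          by (auto simp: ballG_def)
        have "dI (z i) (z j) \<le> dI (z i) v + dI v (z j)"
          by (rule dI_triangle) (use zK ij v in auto)
        moreover have "dI x (z j) \<le> dI x (z i) + dI (z i) (z j)"
          by (rule dI_triangle) (use zK ij x in auto)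
        ultimately have "j * t \<le> i * t + dI (z i) v + dI (z j) v"
          using z(2) ij dI_commute[of v "z j"] by simp
        moreover have "(i + 1) * t \<le> j * t" by (rule mult_right_mono) (use ij in auto)
        ultimately have "t \<le> dI (z i) v + dI (z j) v" by simp
        then have "real t \<le> real (dI (z i) v) + real (dI (z j) v)" by linarith
        then show False using t v by linarith
      qed
      have "real M * (c / D * V x (2 * R)) = (\<Sum>i<M. c / D * V x (2 * R))" by simp
      also have "\<dots> \<le> (\<Sum>i<M. vol wt (?b i))"
      proof (rule sum_mono)
        fix i assume i: "i \<in> {..<M}"
        have "V x (2 * R) \<le> D * V (z i) R" by (rule D(2)) (use zB i R in force)+
        then have "c / D * V x (2 * R) \<le> c * V (z i) R" using c D by (simp add: field_simps)
        also have "\<dots> \<le> vol wt (?b i)" using c(2)[of "z i" R] zK i R by (simp add: VG_def)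
        finally show "c / D * V x (2 * R) \<le> vol wt (?b i)" .
      qed
      also have "\<dots> = vol wt (\<Union>i<M. ?b i)"
        unfolding vol_def
      proof (rule sum.UNION_disjoint[symmetric])
        show "\<forall>i\<in>{..<M}. finite (?b i)" using finite_ballG zK by blast
        show "\<forall>i\<in>{..<M}. \<forall>j\<in>{..<M}. i \<noteq> j \<longrightarrow> ?b i \<inter> ?b j = {}"
          using disj by (metis Int_commute lessThan_iff linorder_neqE_nat)
      qed simp
      also have "\<dots> \<le> V x (2 * R)"
      proof (rule vol_mono[OF finite_ball], rule UN_least)
        fix i assume i: "i \<in> {..<M}"
        have "?b i \<subseteq> B (z i) R" by (rule ballG_subset) (use zK i in blast)
        also have "\<dots> \<subseteq> B x (2 * R)"
        proof
          fix v assume "v \<in> B (z i) R"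
          then show "v \<in> B x (2 * R)" using zB[of i] i d_triangle[of x v "z i"] by auto
        qed
        finally show "?b i \<subseteq> B x (2 * R)" .
      qed
      finally have "(real M * (c / D)) * V x (2 * R) \<le> 1 * V x (2 * R)" by (simp add: mult.assoc)
      moreover have "V x (2 * R) > 0" by (rule V_pos) (use R in simp)
      ultimately have "real M * (c / D) \<le> 1" by (simp only: mult_le_cancel_right_pos)
      then show False using M c D by (simp add: field_simps)
    qed
  qed
  moreover have "3 * real M \<ge> 1" using M0 by simp
  ultimately show ?thesis by blast
qed

lemma inner_tail:
  "\<exists>C c. C \<ge> 1 \<and> c > 0 \<and> (\<forall>x n R. x \<notin> K \<longrightarrow> n \<ge> 1 \<longrightarrow> 0 \<le> R \<longrightarrow>
     killed (-K) n (indicator {w. R < real (dI x w)}) x \<le> C * exp (- c * R\<^sup>2 / n))"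
proof -
  obtain C c where C: "C \<ge> 1" and c: "c > 0"
    and ex: "\<And>x n R. n \<ge> 1 \<Longrightarrow> 0 \<le> R \<Longrightarrow> hit (- B x R) n x \<le> C * exp (- c * R\<^sup>2 / n)"
    using exit_bound by blast
  obtain A where A: "A \<ge> 1" and comp: "\<And>x R w. x \<notin> K \<Longrightarrow> 0 \<le> R \<Longrightarrow>
      (\<lambda>u v. adjI u v \<and> v \<in> B x R)\<^sup>*\<^sup>* x w \<Longrightarrow> real (dI x w) \<le> A * R"
    using component_diameter by blast
  have "killed (-K) n (indicator {w. R < real (dI x w)}) x \<le> C * exp (- (c / A\<^sup>2) * R\<^sup>2 / n)"
    if x: "x \<notin> K" and n: "n \<ge> 1" and R: "0 \<le> R" for x n R
  proof -
    let ?E = "\<lambda>u v. adjI u v \<and> v \<in> B x (R / A)"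
    have R': "0 \<le> R / A" using R A by simp
    have "killed (-K) n (indicator {w. R < real (dI x w)}) x \<le> hit (- B x (R / A)) n x"
    proof (rule killed_component_le_exit[where C = "{w. ?E\<^sup>*\<^sup>* x w}"])
      fix y z assume y: "y \<in> {w. ?E\<^sup>*\<^sup>* x w}" and z: "z \<in> N y"
      have yK: "y \<notin> K" using dI_intermediate[of ?E x y] y x by auto
      show "z \<in> {w. ?E\<^sup>*\<^sup>* x w} \<or> z \<in> K \<or> z \<notin> B x (R / A)"
      proof (cases "z = y \<or> z \<in> K \<or> z \<notin> B x (R / A)")
        case False
        then have "?E y z" using z yK by (auto simp: adjG_def nbrs_def)
        with y[unfolded mem_Collect_eq] have "?E\<^sup>*\<^sup>* x z" by (rule rtranclp.rtrancl_into_rtrancl)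
        then show ?thesis by blast
      qed (use y in auto)
    next
      show "{w. ?E\<^sup>*\<^sup>* x w} \<inter> {w. R < real (dI x w)} = {}"
      proof (rule ccontr)
        assume "\<not> ?thesis"
        then obtain w where "?E\<^sup>*\<^sup>* x w" "R < real (dI x w)" by auto
        with comp[OF x R', of w] A show False by simp
      qed
    qed simp
    also have "\<dots> \<le> C * exp (- c * (R / A)\<^sup>2 / n)" by (rule ex[OF n R'])
    also have "- c * (R / A)\<^sup>2 / n = - (c / A\<^sup>2) * R\<^sup>2 / n" by (simp add: power_divide)
    finally show ?thesis .
  qed
  moreover have "c / A\<^sup>2 > 0" using c A by simp
  ultimately show ?thesis using C by blast
qed


section \<open>Hitting probabilities and the boundary sum\<close>

abbreviation "A \<equiv> inner_bdry K adj"

lemma bdry_sum_eq: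
  assumes "x \<notin> K"
  shows "bdry_sum K adj wt x = (\<Sum>n. ennreal (VI K adj wt x (sqrt (real n)) / VG K adj wt x (sqrt (real n))))"
proof -
  have "(if \<exists>z\<in>A. (dI x z)\<^sup>2 \<le> n then invWI K adj wt x (sqrt n) else 0)
      = VI K adj wt x (sqrt (real n)) / VG K adj wt x (sqrt (real n))" for n
  proof (cases "\<exists>z\<in>A. (dI x z)\<^sup>2 \<le> n")
    case False
    have "ballG K adj x (sqrt n) \<inter> A = {}"
    proof (rule ccontr)
      assume "\<not> ?thesis"
      then obtain z where z: "z \<in> A" "real (dI x z) \<le> sqrt n" by (auto simp: ballG_def)
      then have "(real (dI x z))\<^sup>2 \<le> n" using power_mono[of "real (dI x z)" "sqrt n" 2] by simp
      then have "(dI x z)\<^sup>2 \<le> n" by (metis of_nat_le_iff of_nat_power)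
      with False z show False by blast
    qed
    then have "VI K adj wt x (sqrt n) = 0" by (simp add: VI_def vol_def)
    with False show ?thesis by simp
  qed (auto simp: invWI_def WI_def)
  then show ?thesis unfolding bdry_sum_def by simp
qed

lemma green_Suc:
  assumes "x \<notin> K"
  shows "(\<Sum>n<Suc m. killed (-K) n f x) = f x + (\<Sum>z\<in>N x. P x z * (\<Sum>n<m. killed (-K) n f z))"
proof -
  have "(\<Sum>n<Suc m. killed (-K) n f x) = f x + (\<Sum>n<m. \<Sum>z\<in>N x. P x z * killed (-K) n f z)"
    using assms by (simp add: sum.lessThan_Suc_shift del: sum.lessThan_Suc sum.insert)
  also have "(\<Sum>n<m. \<Sum>z\<in>N x. P x z * killed (-K) n f z) = (\<Sum>z\<in>N x. P x z * (\<Sum>n<m. killed (-K) n f z))"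
    by (subst sum.swap) (simp only: sum_distrib_left)
  finally show ?thesis .
qed

text \<open>From a vertex of the inner boundary the walk steps into \<open>K\<close> with probability between
  \<open>1 / Cc\<close> and 1, so the hitting probability is comparable to the expected time that the
  killed walk spends on the inner boundary.\<close>

lemma hit_le_green: "x \<notin> K \<Longrightarrow> hit K m x \<le> (\<Sum>n<m. killed (-K) n (indicator A) x)"
proof (induction m arbitrary: x)
  case (Suc m)
  have "hit K m z \<le> indicator A x + (\<Sum>n<m. killed (-K) n (indicator A) z)" if "z \<in> N x" for z
  proof (cases "z \<in> K")
    case True
    then have "x \<in> A" using that Suc.prems by (auto simp: inner_bdry_def nbrs_def)
    then show ?thesis using hit_le_1[of K m z] True by (simp add: killed_outside)
  next
    case False
    have "(0::real) \<le> indicator A x" by simp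
    with Suc.IH[OF False] show ?thesis by linarith
  qed
  then have "hit K (Suc m) x \<le>
      (\<Sum>z\<in>N x. P x z * (indicator A x + (\<Sum>n<m. killed (-K) n (indicator A) z)))"
    using Suc.prems by (auto simp del: sum.insert intro!: sum_mono mult_left_mono)
  also have "\<dots> = (\<Sum>z\<in>N x. P x z) * indicator A x
      + (\<Sum>z\<in>N x. P x z * (\<Sum>n<m. killed (-K) n (indicator A) z))"
    by (simp only: distrib_left sum.distrib sum_distrib_right)
  also have "\<dots> = (\<Sum>n<Suc m. killed (-K) n (indicator A) x)"
    using green_Suc[OF Suc.prems, where f = "indicator A" and m = m] by (simp del: sum.insert sum.lessThan_Suc)
  finally show ?case .
qed simp

lemma green_le_hit: "x \<notin> K \<Longrightarrow> (\<Sum>n<m. killed (-K) n (indicator A) x) \<le> Cc * hit K m x"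
proof (induction m arbitrary: x)
  case 0
  then show ?case by simp
next
  case (Suc m)
  let ?G = "\<lambda>z. \<Sum>n<m. killed (-K) n (indicator A) z"
  have Gz: "?G z + Cc * indicator K z \<le> Cc * hit K m z" for z
    using Suc.IH[of z] by (cases "z \<in> K") (auto simp: killed_outside hit_inside)
  have "indicator A x \<le> (\<Sum>z\<in>N x. P x z * (Cc * indicator K z))"
  proof (cases "x \<in> A")
    case True
    then obtain z where z: "z \<in> K" "adj x z" by (auto simp: inner_bdry_def)
    have "1 \<le> P x z * (Cc * indicator K z)" using P_adj_ge[OF z(2)] z Cc_pos by (simp add: field_simps)
    also have "\<dots> \<le> (\<Sum>z\<in>N x. P x z * (Cc * indicator K z))"
      by (rule member_le_sum) (use z Cc_pos in \<open>auto simp: nbrs_def finite_nbrs[unfolded nbrs_def]\<close>)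
    finally show ?thesis using True by simp
  next
    case False
    have "0 \<le> (\<Sum>z\<in>N x. P x z * (Cc * indicator K z))"
      by (rule sum_nonneg) (use Cc_pos in auto)
    then show ?thesis using False by simp
  qed
  then have "(\<Sum>n<Suc m. killed (-K) n (indicator A) x)
      \<le> (\<Sum>z\<in>N x. P x z * (Cc * indicator K z)) + (\<Sum>z\<in>N x. P x z * ?G z)"
    unfolding green_Suc[OF Suc.prems] by linarith
  also have "\<dots> = (\<Sum>z\<in>N x. P x z * (?G z + Cc * indicator K z))"
    by (simp only: distrib_left sum.distrib add.commute)
  also have "\<dots> \<le> (\<Sum>z\<in>N x. P x z * (Cc * hit K m z))"
    by (intro sum_mono mult_left_mono Gz) auto
  also have "\<dots> = Cc * hit K (Suc m) x"
    using Suc.prems by (simp add: sum_distrib_left mult_ac del: sum.insert)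
  finally show ?case .
qed

subsection \<open>Small boundary sum implies transience\<close>

text \<open>For times below \<open>d\<^sub>\<Gamma>(x,y)\<^sup>2\<close>, one of the two halves of the path must travel an unusually
  large inner distance.\<close>

lemma q_upper_inner:
  "\<exists>C>0. \<forall>x y n. x \<notin> K \<longrightarrow> y \<notin> K \<longrightarrow> n < (dI x y)\<^sup>2 \<longrightarrow>
     q (-K) n x y \<le> C * wt y / V x (real (dI x y))"
proof -
  obtain C0 c where C0: "C0 \<ge> 1" and c: "c > 0"
    and tail: "\<And>x n R. x \<notin> K \<Longrightarrow> n \<ge> 1 \<Longrightarrow> 0 \<le> R \<Longrightarrow>
     killed (-K) n (indicator {w. R < real (dI x w)}) x \<le> C0 * exp (- c * R\<^sup>2 / n)"
    using inner_tail by blast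
  obtain C1 where C1: "C1 \<ge> 1" and Vexp: "\<And>x n r. n \<ge> 1 \<Longrightarrow> 0 \<le> r \<Longrightarrow> r \<le> real n \<Longrightarrow>
    V x r \<le> C1 * exp (c * r\<^sup>2 / n) * V x (sqrt n)"
    using V_exp[OF c] by blast
  obtain D where D: "D \<ge> 1"
    "\<And>x y r. 0 \<le> r \<Longrightarrow> real (d x y) \<le> 6 * r \<Longrightarrow> V x (6 * r) \<le> D * V y r"
    using doubling_translate[of 6] by blast
  define C where "C = 2 * (c3 * C0 * (D * C1))"
  have C_pos: "C > 0" using c_pos C0 D C1 by (simp add: C_def)
  have "q (-K) n x y \<le> C * wt y / V x (real (dI x y))"
    if x: "x \<notin> K" and y: "y \<notin> K" and n: "n < (dI x y)\<^sup>2" for x y n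
  proof (cases "n < dI x y")
    case True
    then show ?thesis using C_pos by (simp add: q_zero_dG)
  next
    case False
    define \<rho> where "\<rho> = dI x y"
    have "\<rho> * 1 < \<rho> * \<rho>" using False n unfolding \<rho>_def power2_eq_square by linarith
    then have \<rho>2: "2 \<le> \<rho>" unfolding mult_less_cancel1 by linarith
    have n\<rho>: "\<rho> \<le> n" using False by (simp add: \<rho>_def)
    define n1 where "n1 = n div 2"
    define n2 where "n2 = n - n1"
    have n12: "n = n1 + n2" "1 \<le> n1" "1 \<le> n2" "n1 \<le> 2 * n2" "n2 \<le> 2 * n1"
      using n\<rho> \<rho>2 by (auto simp: n1_def n2_def)
    have n1': "\<rho> \<le> 2 * n1 + 1" "\<rho> \<le> 2 * n2 + 1" using n\<rho> by (auto simp: n1_def n2_def)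
    define r where "r = real \<rho> / 6"
    have r0: "0 \<le> r" by (simp add: r_def)
    have r1: "r \<le> real n1" "r \<le> real n2" using n1' \<rho>2 unfolding r_def by linarith+
    have dxy: "real (d x y) \<le> 6 * r" using d_le_dI[OF x y] by (simp add: r_def \<rho>_def)
    have V\<rho>: "V x (real \<rho>) > 0" by (rule V_pos) simp
    have key: "1 / V u (sqrt m) * (C0 * exp (- c * (2 * r)\<^sup>2 / m')) \<le> C0 * (D * C1) / V x (real \<rho>)"
      if u: "u = x \<or> u = y" and m: "1 \<le> m" "1 \<le> m'" "m' \<le> 2 * m" "r \<le> real m" for u m m'
    proof -
      have Vu: "V u (sqrt m) > 0" by (rule V_pos) simp
      have "V x (real \<rho>) = V x (6 * r)" by (simp add: r_def)
      also have "\<dots> \<le> D * V u r" by (rule D(2)) (use u r0 dxy in auto)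
      also have "\<dots> \<le> D * (C1 * exp (c * r\<^sup>2 / m) * V u (sqrt m))"
        by (intro mult_left_mono Vexp) (use m r0 D in auto)
      finally have le: "V x (real \<rho>) \<le> D * C1 * exp (c * r\<^sup>2 / m) * V u (sqrt m)" by (simp add: mult_ac)
      have "c * r\<^sup>2 * real m' \<le> c * r\<^sup>2 * (4 * real m)" using m c by (intro mult_left_mono) auto
      then have "c * r\<^sup>2 / m \<le> c * (2 * r)\<^sup>2 / m'"
        using m by (simp add: field_simps)
      then have "exp (c * r\<^sup>2 / m) * exp (- c * (2 * r)\<^sup>2 / m') \<le> 1"
        unfolding exp_add[symmetric] by simp
      then have e: "exp (- c * (2 * r)\<^sup>2 / m') \<le> 1 / exp (c * r\<^sup>2 / m)" by (simp add: field_simps)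
      have "1 / V u (sqrt m) * (C0 * exp (- c * (2 * r)\<^sup>2 / m'))
          \<le> 1 / V u (sqrt m) * (C0 * (1 / exp (c * r\<^sup>2 / m)))"
        by (intro mult_left_mono e) (use C0 Vu in auto)
      also have "\<dots> = C0 * (1 / (exp (c * r\<^sup>2 / m) * V u (sqrt m)))" by simp
      also have "\<dots> \<le> C0 * ((D * C1) / V x (real \<rho>))"
        by (rule mult_left_mono) (use le Vu V\<rho> C0 in \<open>auto simp: field_simps\<close>)
      finally show ?thesis by simp
    qed
    define F where "F = {w. 2 * r < real (dI x w)}"
    define F' where "F' = {w. 2 * r < real (dI y w)}"
    have cover: "w \<in> F \<or> w \<in> F'" if "w \<notin> K" for w
    proof -
      have "dI x y \<le> dI x w + dI w y" by (rule dI_triangle) (use x y that in auto)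
      then have "6 * r \<le> real (dI x w) + real (dI y w)"
        using dI_commute[of w y] by (simp add: r_def \<rho>_def)
      moreover have "0 < r" using \<rho>2 by (simp add: r_def)
      ultimately show ?thesis unfolding F_def F'_def mem_Collect_eq by linarith
    qed
    have "q (-K) n x y = killed (-K) n1 (\<lambda>w. q (-K) n2 w y) x" by (simp only: n12 killed_comp)
    also have "\<dots> \<le> killed (-K) n1 (\<lambda>w. c3 * wt y / V y (sqrt n2) * indicator F w
        + indicator F' w * q (-K) n2 w y) x"
    proof (rule killed_mono)
      fix w assume "w \<in> - K"
      then have "w \<in> F \<or> w \<in> F'" using cover by blast
      moreover have "0 \<le> c3 * wt y / V y (sqrt n2)" using c_pos by simp
      ultimately show "q (-K) n2 w y \<le> c3 * wt y / V y (sqrt n2) * indicator F w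
        + indicator F' w * q (-K) n2 w y"
        using q_upper_right[of "-K" n2 y w] by (auto simp: indicator_def)
    qed
    also have "\<dots> = c3 * wt y / V y (sqrt n2) * killed (-K) n1 (indicator F) x
        + killed (-K) n1 (\<lambda>w. indicator F' w * q (-K) n2 w y) x"
      by (simp only: killed_add killed_cmult)
    also have "c3 * wt y / V y (sqrt n2) * killed (-K) n1 (indicator F) x
        \<le> c3 * wt y / V y (sqrt n2) * (C0 * exp (- c * (2 * r)\<^sup>2 / n1))"
      unfolding F_def by (intro mult_left_mono tail) (use x n12 r0 c_pos in auto)
    also have "\<dots> = c3 * wt y * (1 / V y (sqrt n2) * (C0 * exp (- c * (2 * r)\<^sup>2 / n1)))" by simp
    also have "\<dots> \<le> c3 * wt y * (C0 * (D * C1) / V x (real \<rho>))"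
      by (intro mult_left_mono key) (use n12 r1 c_pos in auto)
    also have "killed (-K) n1 (\<lambda>w. indicator F' w * q (-K) n2 w y) x
        \<le> c3 * wt y * (C0 * (D * C1) / V x (real \<rho>))"
    proof -
      have "killed (-K) n1 (\<lambda>w. indicator F' w * q (-K) n2 w y) x
         = (\<Sum>w\<in>B x n1. q (-K) n1 x w * (indicator F' w * q (-K) n2 w y))"
        by (rule killed_expand) simp
      also have "\<dots> \<le> (\<Sum>w\<in>B x n1. c3 * wt y / V x (sqrt n1) * (indicator F' w * q (-K) n2 y w))"
      proof (rule sum_mono)
        fix w
        have "q (-K) n1 x w * (indicator F' w * q (-K) n2 w y)
          \<le> c3 * wt w / V x (sqrt n1) * (indicator F' w * q (-K) n2 w y)"
          by (intro mult_right_mono q_upper_left) auto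
        also have "\<dots> = c3 / V x (sqrt n1) * (indicator F' w * (wt w * q (-K) n2 w y))" by simp
        also have "\<dots> = c3 * wt y / V x (sqrt n1) * (indicator F' w * q (-K) n2 y w)"
          by (subst q_reversible) simp
        finally show "q (-K) n1 x w * (indicator F' w * q (-K) n2 w y)
          \<le> c3 * wt y / V x (sqrt n1) * (indicator F' w * q (-K) n2 y w)" .
      qed
      also have "\<dots> = c3 * wt y / V x (sqrt n1) * (\<Sum>w\<in>B x n1. q (-K) n2 y w * indicator F' w)"
        unfolding sum_distrib_left by (intro sum.cong refl) simp
      also have "(\<Sum>w\<in>B x n1. q (-K) n2 y w * indicator F' w)
          = (\<Sum>w\<in>B x n1. q (-K) n2 y w * indicator (F' \<inter> B x n1) w)"
        by (intro sum.cong) (auto simp: indicator_def)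
      also have "\<dots> = killed (-K) n2 (indicator (F' \<inter> B x n1)) y"
        by (rule killed_expand_finite[symmetric]) auto
      also have "c3 * wt y / V x (sqrt n1) * \<dots>
          \<le> c3 * wt y / V x (sqrt n1) * killed (-K) n2 (indicator F') y"
        by (intro mult_left_mono killed_mono) (use c_pos in \<open>auto simp: indicator_def\<close>)
      also have "\<dots> \<le> c3 * wt y / V x (sqrt n1) * (C0 * exp (- c * (2 * r)\<^sup>2 / n2))"
        unfolding F'_def by (intro mult_left_mono tail) (use y n12 r0 c_pos in auto)
      also have "\<dots> = c3 * wt y * (1 / V x (sqrt n1) * (C0 * exp (- c * (2 * r)\<^sup>2 / n2)))" by simp
      also have "\<dots> \<le> c3 * wt y * (C0 * (D * C1) / V x (real \<rho>))"
        by (intro mult_left_mono key) (use n12 r1 c_pos in auto)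
      finally show ?thesis .
    qed
    finally show ?thesis by (simp add: C_def \<rho>_def mult_ac)
  qed
  with C_pos show ?thesis by blast
qed

lemma green_upper:
  "\<exists>C>0. \<forall>x (m::nat). x \<notin> K \<longrightarrow> (\<Sum>n<m. killed (-K) n (indicator A) x) \<le>
     C * (\<Sum>n<2 * m\<^sup>2 + m. VI K adj wt x (sqrt (real n)) / VG K adj wt x (sqrt (real n)))"
proof -
  obtain C where C: "C > 0" and qu: "\<And>x y n. x \<notin> K \<Longrightarrow> y \<notin> K \<Longrightarrow> n < (dI x y)\<^sup>2 \<Longrightarrow>
     q (-K) n x y \<le> C * wt y / V x (real (dI x y))"
    using q_upper_inner by blast
  obtain D where D: "D \<ge> 1" "\<And>x r. 0 \<le> r \<Longrightarrow> V x (2 * r) \<le> D * V x r" using doubling by blast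
  define C' where "C' = C * D + c3"
  have C': "C' > 0" using C D c_pos by (simp add: C'_def add_pos_pos)
  have "(\<Sum>n<m. killed (-K) n (indicator A) x) \<le>
     C' * (\<Sum>n<2 * m\<^sup>2 + m. VI K adj wt x (sqrt (real n)) / VG K adj wt x (sqrt (real n)))" if x: "x \<notin> K" for x m
  proof -
    define T where "T = 2 * m\<^sup>2 + m"
    define Y where "Y = ballG K adj x (real m) \<inter> A"
    have finY: "finite Y" unfolding Y_def using finite_ballG[OF x] by blast
    have YK: "y \<notin> K" "dI x y \<le> m" if "y \<in> Y" for y using that by (auto simp: Y_def ballG_def)
    have kY: "killed (-K) n (indicator A) x = (\<Sum>y\<in>Y. q (-K) n x y)" if "n < m" for n
    proof -
      have "killed (-K) n (indicator A) x = killed (-K) n (indicator Y) x"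
      proof (rule killed_cong)
        fix i y assume "i \<le> n" "(adjG (- (- K)) adj ^^ i) x y" "y \<in> - K"
        then have "dI x y \<le> m" using dI_le_relpowp[of i x y] that by simp
        then show "indicator A y = (indicator Y y :: real)"
          using \<open>y \<in> - K\<close> by (auto simp: Y_def ballG_def indicator_def)
      qed
      also have "\<dots> = (\<Sum>y\<in>Y. q (-K) n x y)"
        by (subst killed_expand_finite[OF finY]) (auto simp: indicator_def)
      finally show ?thesis .
    qed
    have per_y: "(\<Sum>n<m. q (-K) n x y) \<le> C' * (\<Sum>n<T. if (dI x y)\<^sup>2 \<le> n then wt y / V x (sqrt n) else 0)"
      if y: "y \<in> Y" for y
    proof -
      define \<rho> where "\<rho> = dI x y"
      have Vp: "V x (real \<rho>) > 0" "V x (sqrt (real n)) > 0" for n by (auto intro!: V_pos)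
      have "\<rho>\<^sup>2 \<le> m\<^sup>2" using YK[OF y] by (simp add: \<rho>_def power_mono)
      then have rm: "2 * \<rho>\<^sup>2 \<le> T" unfolding T_def by linarith
      let ?g = "\<lambda>n. wt y / V x (sqrt n)"
      have "(\<Sum>n\<in>{..<m} \<inter> {..<\<rho>\<^sup>2}. q (-K) n x y) \<le> (\<Sum>n\<in>{..<\<rho>\<^sup>2}. C * wt y / V x (real \<rho>))"
      proof (rule order_trans[OF sum_mono2])
        show "(\<Sum>n\<in>{..<\<rho>\<^sup>2}. q (-K) n x y) \<le> (\<Sum>n\<in>{..<\<rho>\<^sup>2}. C * wt y / V x (real \<rho>))"
          by (rule sum_mono) (use qu x YK[OF y] in \<open>auto simp: \<rho>_def\<close>)
      qed auto
      also have "\<dots> = (\<Sum>n\<in>{\<rho>\<^sup>2..<2 * \<rho>\<^sup>2}. C * wt y / V x (real \<rho>))" by simp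
      also have "\<dots> \<le> (\<Sum>n\<in>{\<rho>\<^sup>2..<2 * \<rho>\<^sup>2}. C * D * ?g n)"
      proof (rule sum_mono)
        fix n assume n: "n \<in> {\<rho>\<^sup>2..<2 * \<rho>\<^sup>2}"
        have "sqrt n \<le> 2 * real \<rho>"
        proof (rule real_le_lsqrt)
          have "real n \<le> real (2 * \<rho>\<^sup>2)" using n by (simp only: of_nat_le_iff) simp
          then show "real n \<le> (2 * real \<rho>)\<^sup>2" by (simp add: power_mult_distrib)
        qed auto
        then have "V x (sqrt n) \<le> D * V x (real \<rho>)"
          using V_mono[of "sqrt n" "2 * real \<rho>" x] D(2)[of "real \<rho>" x] by simp
        then have "1 / V x (real \<rho>) \<le> D / V x (sqrt n)" using Vp by (simp add: field_simps)
        then have "C * wt y * (1 / V x (real \<rho>)) \<le> C * wt y * (D / V x (sqrt n))"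
          by (rule mult_left_mono) (use C in simp)
        then show "C * wt y / V x (real \<rho>) \<le> C * D * ?g n" by (simp add: mult_ac)
      qed
      also have "\<dots> \<le> (\<Sum>n\<in>{\<rho>\<^sup>2..<T}. C * D * ?g n)"
        by (rule sum_mono2) (use rm C D(1) Vp(2) in \<open>auto simp: less_imp_le\<close>)
      finally have small: "(\<Sum>n\<in>{..<m} \<inter> {..<\<rho>\<^sup>2}. q (-K) n x y) \<le> (\<Sum>n\<in>{\<rho>\<^sup>2..<T}. C * D * ?g n)" .
      have "(\<Sum>n\<in>{..<m} - {..<\<rho>\<^sup>2}. q (-K) n x y) \<le> (\<Sum>n\<in>{..<m} - {..<\<rho>\<^sup>2}. c3 * ?g n)"
        by (rule sum_mono) (use q_upper_left in simp)
      also have "\<dots> \<le> (\<Sum>n\<in>{\<rho>\<^sup>2..<T}. c3 * ?g n)"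
        by (rule sum_mono2) (use c_pos Vp(2) in \<open>auto simp: T_def less_imp_le\<close>)
      finally have "(\<Sum>n<m. q (-K) n x y) \<le> (\<Sum>n\<in>{\<rho>\<^sup>2..<T}. C * D * ?g n) + (\<Sum>n\<in>{\<rho>\<^sup>2..<T}. c3 * ?g n)"
        using small sum.Int_Diff[of "{..<m}" "\<lambda>n. q (-K) n x y" "{..<\<rho>\<^sup>2}"] by simp
      also have "\<dots> = C' * (\<Sum>n\<in>{\<rho>\<^sup>2..<T}. ?g n)"
        by (simp only: sum_distrib_left[symmetric] C'_def distrib_right)
      also have "(\<Sum>n\<in>{\<rho>\<^sup>2..<T}. ?g n) = (\<Sum>n<T. if \<rho>\<^sup>2 \<le> n then ?g n else 0)"
        by (subst sum.inter_filter[symmetric]) (auto intro!: sum.cong)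
      finally show ?thesis by (simp add: \<rho>_def)
    qed
    have "(\<Sum>n<m. killed (-K) n (indicator A) x) = (\<Sum>n<m. \<Sum>y\<in>Y. q (-K) n x y)"
      by (intro sum.cong) (auto simp: kY)
    also have "\<dots> = (\<Sum>y\<in>Y. \<Sum>n<m. q (-K) n x y)" by (rule sum.swap)
    also have "\<dots> \<le> (\<Sum>y\<in>Y. C' * (\<Sum>n<T. if (dI x y)\<^sup>2 \<le> n then wt y / V x (sqrt n) else 0))"
      by (rule sum_mono) (rule per_y)
    also have "\<dots> = C' * (\<Sum>y\<in>Y. \<Sum>n<T. if (dI x y)\<^sup>2 \<le> n then wt y / V x (sqrt n) else 0)"
      by (simp only: sum_distrib_left)
    also have "(\<Sum>y\<in>Y. \<Sum>n<T. if (dI x y)\<^sup>2 \<le> n then wt y / V x (sqrt n) else 0)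
        = (\<Sum>n<T. \<Sum>y\<in>Y. if (dI x y)\<^sup>2 \<le> n then wt y / V x (sqrt n) else 0)" by (rule sum.swap)
    also have "C' * \<dots> \<le> C' * (\<Sum>n<T. VI K adj wt x (sqrt (real n)) / VG K adj wt x (sqrt (real n)))"
    proof (intro mult_left_mono sum_mono)
      fix n :: nat
      have Vp: "VG K adj wt x (sqrt n) > 0" by (rule VG_pos[OF x]) simp
      have "(\<Sum>y\<in>Y. if (dI x y)\<^sup>2 \<le> n then wt y / V x (sqrt n) else 0)
          = (\<Sum>y\<in>{y\<in>Y. (dI x y)\<^sup>2 \<le> n}. wt y / V x (sqrt n))"
        by (rule sum.inter_filter[symmetric]) (rule finY)
      also have "\<dots> = vol wt {y\<in>Y. (dI x y)\<^sup>2 \<le> n} / V x (sqrt n)"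
        by (simp add: vol_def sum_divide_distrib)
      also have "\<dots> \<le> VI K adj wt x (sqrt (real n)) / VG K adj wt x (sqrt (real n))"
      proof (rule frac_le)
        show "vol wt {y\<in>Y. (dI x y)\<^sup>2 \<le> n} \<le> VI K adj wt x (sqrt n)"
          unfolding VI_def
        proof (rule vol_mono)
          show "{y\<in>Y. (dI x y)\<^sup>2 \<le> n} \<subseteq> ballG K adj x (sqrt n) \<inter> A"
          proof
            fix y assume y: "y \<in> {y\<in>Y. (dI x y)\<^sup>2 \<le> n}"
            then have "real ((dI x y)\<^sup>2) \<le> real n" by (simp only: of_nat_le_iff) simp
            then have "real (dI x y) \<le> sqrt n" by (intro real_le_rsqrt) simp
            then show "y \<in> ballG K adj x (sqrt n) \<inter> A" using y by (auto simp: Y_def ballG_def)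
          qed
        qed (use finite_ballG[OF x] in blast)
      qed (use Vp VG_le_V[OF x] in \<open>auto simp: VI_def\<close>)
      finally show "(\<Sum>y\<in>Y. if (dI x y)\<^sup>2 \<le> n then wt y / V x (sqrt n) else 0)
          \<le> VI K adj wt x (sqrt (real n)) / VG K adj wt x (sqrt (real n))" .
    qed (use C' in simp)
    finally show ?thesis by (simp add: T_def)
  qed
  with C' show ?thesis by blast
qed

lemma transient_if_bdry_sum_small:
  assumes "\<forall>\<epsilon>>0. \<exists>L>0. \<forall>x. x \<notin> K \<longrightarrow> (\<forall>k\<in>K. L \<le> real (d x k)) \<longrightarrow> bdry_sum K adj wt x \<le> ennreal \<epsilon>"
  shows "unif_S_transient adj mu wt K"
proof -
  obtain C where C: "C > 0" and gu: "\<And>x m. x \<notin> K \<Longrightarrow> (\<Sum>n<m. killed (-K) n (indicator A) x) \<le>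
     C * (\<Sum>n<2 * m\<^sup>2 + m. VI K adj wt x (sqrt (real n)) / VG K adj wt x (sqrt (real n)))"
    using green_upper by blast
  have "1 / (2 * C) > 0" using C by simp
  then obtain L where L: "L > 0" and sm: "\<And>x. x \<notin> K \<Longrightarrow> (\<forall>k\<in>K. L \<le> real (d x k)) \<Longrightarrow>
      bdry_sum K adj wt x \<le> ennreal (1 / (2 * C))"
    using assms by blast
  have "psiK adj mu wt K x \<le> 1 - 1 / 2" if far: "\<forall>k\<in>K. L \<le> real (d x k)" for x
    unfolding psiK_def
  proof (rule cSUP_least)
    fix m
    have x: "x \<notin> K" using far L by force
    let ?a = "\<lambda>n. VI K adj wt x (sqrt (real n)) / VG K adj wt x (sqrt (real n))"
    have a0: "0 \<le> ?a n" for n by (simp add: VI_def VG_def)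
    have "ennreal (\<Sum>n<2 * m\<^sup>2 + m. ?a n) = (\<Sum>n<2 * m\<^sup>2 + m. ennreal (?a n))"
      by (rule sum_ennreal[symmetric]) (rule a0)
    also have "\<dots> \<le> (\<Sum>n. ennreal (?a n))" by (rule sum_le_suminf) auto
    also have "\<dots> \<le> ennreal (1 / (2 * C))" using sm[OF x far] by (simp only: bdry_sum_eq[OF x])
    finally have le: "(\<Sum>n<2 * m\<^sup>2 + m. ?a n) \<le> 1 / (2 * C)" using C by (subst (asm) ennreal_le_iff) auto
    have "hit K m x \<le> C * (\<Sum>n<2 * m\<^sup>2 + m. ?a n)"
      using hit_le_green[OF x, of m] gu[OF x, of m] by linarith
    also have "\<dots> \<le> C * (1 / (2 * C))" by (rule mult_left_mono[OF le]) (use C in simp)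
    finally show "hit K m x \<le> 1 - 1 / 2" using C by simp
  qed simp
  then show ?thesis unfolding unif_S_transient_def using L by (intro exI[of _ L] exI[of _ "1 / 2"]) simp
qed


subsection \<open>Transience bounds the boundary sum\<close>

abbreviation "alive n x \<equiv> killed (-K) n (\<lambda>_. 1) x"

lemma alive_ge_everywhere:
  assumes "unif_S_transient adj mu wt K"
  shows "\<exists>\<epsilon>>0. \<forall>x n. x \<notin> K \<longrightarrow> \<epsilon> \<le> alive n x"
proof -
  obtain L \<epsilon> where L: "L > 0" "\<epsilon> > 0"
    and tr: "\<And>x. (\<forall>k\<in>K. L \<le> real (d x k)) \<Longrightarrow> psiK adj mu wt K x \<le> 1 - \<epsilon>"
    using assms unfolding unif_S_transient_def by blast
  define p where "p = min 1 (1 / Cc)"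
  have p: "0 < p" "p \<le> 1" "p \<le> 1 / Cc" using Cc_pos by (auto simp: p_def)
  define j where "j = nat \<lceil>L / cu\<rceil>"
  have j: "L / cu \<le> real j" unfolding j_def by linarith
  have far: "\<epsilon> \<le> alive n w" if "deep L w" for w n
  proof -
    have "hit K n w \<le> psiK adj mu wt K w"
      unfolding psiK_def by (rule cSUP_upper) (auto intro!: bdd_aboveI[of _ 1] hit_le_1)
    also have "\<dots> \<le> 1 - \<epsilon>" by (rule tr) (use that in \<open>simp add: deep_def\<close>)
    finally show ?thesis by (simp add: hit_eq_killed)
  qed
  have alive0: "0 \<le> alive n y" for n y by (rule killed_nonneg) auto
  have step: "p * alive n y \<le> alive n x" if "adjI x y" for x y n
  proof -
    have xy: "adj x y" "x \<notin> K" using that by (auto simp: adjG_def)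
    have "p * alive n y \<le> P x y * alive n y"
      using P_adj_ge[OF xy(1)] p by (intro mult_right_mono alive0) linarith
    also have "\<dots> \<le> (\<Sum>z\<in>N x. P x z * alive n z)"
      by (rule member_le_sum) (use xy alive0 in \<open>auto simp: nbrs_def finite_nbrs[unfolded nbrs_def]\<close>)
    also have "\<dots> = alive (Suc n) x" using xy by simp
    also have "\<dots> \<le> alive n x" using hit_Suc_ge[of K n x] unfolding hit_eq_killed by linarith
    finally show ?thesis .
  qed
  have chain: "(adjI ^^ m) x y \<Longrightarrow> p ^ m * alive n y \<le> alive n x" for m x y n
  proof (induction m arbitrary: y)
    case (Suc m)
    then obtain z where z: "(adjI ^^ m) x z" "adjI z y" by auto
    have "p ^ Suc m * alive n y = p ^ m * (p * alive n y)" by simp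
    also have "\<dots> \<le> p ^ m * alive n z" by (rule mult_left_mono[OF step[OF z(2)]]) (use p in simp)
    also have "\<dots> \<le> alive n x" by (rule Suc.IH[OF z(1)])
    finally show ?case .
  qed simp
  have "p ^ j * \<epsilon> \<le> alive n x" if x: "x \<notin> K" for x n
  proof -
    obtain w where w: "w \<notin> K" "dI x w \<le> j" "deep (cu * (1 + real j)) w"
      using interior_point[OF x] by blast
    have "L \<le> cu * (1 + real j)" using j cu_pos by (simp add: field_simps)
    then have "deep L w" by (rule deep_mono[OF w(3)])
    have "(adjI ^^ dI x w) x w" unfolding dG_def by (intro relpowp_gdist adjI_conn x w)
    have "p ^ j * \<epsilon> \<le> p ^ dI x w * alive n w"
      by (intro mult_mono power_decreasing far \<open>deep L w\<close> w(2)) (use p L in auto)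
    also have "\<dots> \<le> alive n x" by (rule chain) fact
    finally show ?thesis .
  qed
  moreover have "p ^ j * \<epsilon> > 0" using p L by simp
  ultimately show ?thesis by blast
qed

text \<open>Each vertex at depth less than \<open>s\<close> has, at distance of order \<open>s\<close>, a ball of radius \<open>s\<close>
  of vertices whose depth is comparable to \<open>s\<close>; double counting compares the volumes.\<close>

lemma shallow_le_layer:
  "\<exists>C M. C > 0 \<and> M \<ge> 2 \<and> (\<forall>x r s. 1 \<le> s \<longrightarrow> M * s \<le> r \<longrightarrow>
     vol wt {z \<in> B x r. z \<notin> K \<and> \<not> deep s z}
       \<le> C * vol wt {v \<in> B x (2 * r). deep s v \<and> \<not> deep (M * s) v})"
proof -
  define M where "M = 2 / cu + 4"
  have M: "M \<ge> 4" using cu_pos by (simp add: M_def)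
  obtain D where D: "D \<ge> 1"
    "\<And>x y r. 0 \<le> r \<Longrightarrow> real (d x y) \<le> M * r \<Longrightarrow> V x (M * r) \<le> D * V y r"
    using doubling_translate[of M] by blast
  have "vol wt {z \<in> B x r. z \<notin> K \<and> \<not> deep s z}
       \<le> D * vol wt {v \<in> B x (2 * r). deep s v \<and> \<not> deep (M * s) v}"
    if s: "1 \<le> s" and r: "M * s \<le> r" for x r s
  proof -
    define E where "E = {z \<in> B x r. z \<notin> K \<and> \<not> deep s z}"
    define F where "F = {v \<in> B x (2 * r). deep s v \<and> \<not> deep (M * s) v}"
    have fin: "finite E" "finite F" unfolding E_def F_def by (auto simp del: mem_ball)
    have "\<exists>w. real (d z w) \<le> (2 / cu + 1) * s \<and> deep (2 * s) w" if z: "z \<in> E" for z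
    proof -
      define j where "j = nat \<lceil>2 * s / cu\<rceil>"
      have j: "2 * s / cu \<le> real j" "real j \<le> 2 * s / cu + 1"
        unfolding j_def using s cu_pos by (auto simp: less_imp_le)
      obtain w where w: "w \<notin> K" "dI z w \<le> j" "deep (cu * (1 + real j)) w"
        using interior_point[of z j] z by (auto simp: E_def)
      have "d z w \<le> dI z w" by (rule d_le_dI) (use z w in \<open>auto simp: E_def\<close>)
      then have "real (d z w) \<le> real j" using w(2) by linarith
      also have "\<dots> \<le> (2 / cu + 1) * s" using j(2) s by (simp add: distrib_right)
      finally have "real (d z w) \<le> (2 / cu + 1) * s" .
      moreover have "2 * s \<le> cu * (1 + real j)" using j cu_pos by (simp add: field_simps)
      then have "deep (2 * s) w" by (rule deep_mono[OF w(3)])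
      ultimately show ?thesis by blast
    qed
    then obtain w where w: "\<And>z. z \<in> E \<Longrightarrow> real (d z (w z)) \<le> (2 / cu + 1) * s"
      "\<And>z. z \<in> E \<Longrightarrow> deep (2 * s) (w z)" by metis
    have near: "real (d v z) \<le> (2 / cu + 2) * s" if "z \<in> E" "v \<in> B (w z) s" for z v
      using w(1)[OF that(1)] that(2) d_triangle[of z v "w z"] d_commute[of z v]
      by (simp add: distrib_right)
    have sub: "B (w z) s \<subseteq> F" if z: "z \<in> E" for z
    proof
      fix v assume v: "v \<in> B (w z) s"
      have ms: "(2 / cu + 2) * s = M * s - 2 * s" by (simp add: M_def algebra_simps)
      have "real (d x v) \<le> real (d x z) + real (d v z)"
        using d_triangle[of x v z] d_commute[of z v] by simp
      then have "real (d x v) \<le> 2 * r" using near[OF z v] z ms r s by (simp add: E_def)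
      moreover have "deep s v" by (rule deep_translate[OF w(2)[OF z]]) (use v in simp)
      moreover have "\<not> deep (M * s) v"
      proof
        assume dv: "deep (M * s) v"
        obtain k where k: "k \<in> K" "real (d z k) < s" using z by (auto simp: E_def deep_def not_le)
        have "M * s \<le> real (d v k)" using dv k by (simp add: deep_def)
        also have "\<dots> \<le> real (d v z) + real (d z k)" using d_triangle[of v k z] by simp
        finally show False using near[OF z v] k ms s by linarith
      qed
      ultimately show "v \<in> F" by (simp add: F_def)
    qed
    have Vp: "V u s > 0" "V u (M * s) > 0" for u using s M by (auto intro!: V_pos)
    have one: "(\<Sum>v\<in>F. if v \<in> B (w z) s then wt v / V (w z) s else 0) = 1" if z: "z \<in> E" for z
    proof -
      have "(\<Sum>v\<in>F. if v \<in> B (w z) s then wt v / V (w z) s else 0) = (\<Sum>v\<in>B (w z) s. wt v / V (w z) s)"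
        using sub[OF z] fin(2) by (subst sum.inter_restrict[symmetric]) (auto simp: Int_absorb1)
      also have "\<dots> = V (w z) s / V (w z) s" by (simp only: vol_def sum_divide_distrib)
      finally show ?thesis using Vp(1)[of "w z"] by simp
    qed
    have "vol wt E = (\<Sum>z\<in>E. wt z)" by (simp only: vol_def)
    also have "\<dots> = (\<Sum>z\<in>E. wt z * (\<Sum>v\<in>F. if v \<in> B (w z) s then wt v / V (w z) s else 0))"
      by (intro sum.cong refl) (simp only: one mult_1_right)
    also have "\<dots> \<le> (\<Sum>z\<in>E. wt z * (\<Sum>v\<in>F. if z \<in> B v (M * s) then wt v * (D / V v (M * s)) else 0))"
    proof (intro sum_mono mult_left_mono)
      fix z v assume z: "z \<in> E"
      show "(if v \<in> B (w z) s then wt v / V (w z) s else 0)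
        \<le> (if z \<in> B v (M * s) then wt v * (D / V v (M * s)) else 0)"
      proof (cases "v \<in> B (w z) s")
        case True
        have "(2 / cu + 2) * s \<le> M * s" using s by (intro mult_right_mono) (auto simp: M_def)
        then have zv: "z \<in> B v (M * s)" using near[OF z True] by simp
        have "V v (M * s) \<le> D * V (w z) s"
        proof (rule D(2))
          have "s \<le> M * s" using s M by simp
          then show "real (d v (w z)) \<le> M * s" using True d_commute[of v "w z"] by simp
        qed (use s in simp)
        then have "1 / V (w z) s \<le> D / V v (M * s)" using Vp by (simp add: field_simps)
        then have "wt v * (1 / V (w z) s) \<le> wt v * (D / V v (M * s))" by (rule mult_left_mono) simp
        then show ?thesis using True zv by simp
      next
        case False
        then show ?thesis using D(1) by simp
      qed
    qed simp
    also have "\<dots> = (\<Sum>z\<in>E. \<Sum>v\<in>F. wt v * (D / V v (M * s)) * (if z \<in> B v (M * s) then wt z else 0))"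
      unfolding sum_distrib_left by (intro sum.cong refl) simp
    also have "\<dots> = (\<Sum>v\<in>F. wt v * (D / V v (M * s)) * (\<Sum>z\<in>E. if z \<in> B v (M * s) then wt z else 0))"
      by (subst sum.swap) (simp only: sum_distrib_left)
    also have "\<dots> \<le> (\<Sum>v\<in>F. wt v * (D / V v (M * s)) * V v (M * s))"
    proof (intro sum_mono mult_left_mono)
      fix v
      have "(\<Sum>z\<in>E. if z \<in> B v (M * s) then wt z else 0) = vol wt (E \<inter> B v (M * s))"
        unfolding vol_def using fin(1) by (subst sum.inter_restrict) auto
      also have "\<dots> \<le> V v (M * s)" by (rule vol_mono) auto
      finally show "(\<Sum>z\<in>E. if z \<in> B v (M * s) then wt z else 0) \<le> V v (M * s)" .
    qed (use D(1) in auto)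
    also have "\<dots> = (\<Sum>v\<in>F. D * wt v)"
    proof (intro sum.cong refl)
      fix v
      show "wt v * (D / V v (M * s)) * V v (M * s) = D * wt v" using Vp(2)[of v] by simp
    qed
    also have "\<dots> = D * vol wt F" by (simp only: vol_def sum_distrib_left)
    finally show ?thesis by (simp add: E_def F_def)
  qed
  then show ?thesis using D(1) M by (intro exI[of _ D] exI[of _ M]) auto
qed

lemma shallow_volume:
  assumes "\<eta> > 0"
  shows "\<exists>\<delta> r0. \<delta> > 0 \<and> (\<forall>x r. r0 \<le> r \<longrightarrow> vol wt {z \<in> B x r. z \<notin> K \<and> \<not> deep (\<delta> * r) z} \<le> \<eta> * V x r)"
proof -
  obtain C M where C: "C > 0" and M: "M \<ge> 2" and layer: "\<And>x r s. 1 \<le> s \<Longrightarrow> M * s \<le> r \<Longrightarrow>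
     vol wt {z \<in> B x r. z \<notin> K \<and> \<not> deep s z}
       \<le> C * vol wt {v \<in> B x (2 * r). deep s v \<and> \<not> deep (M * s) v}"
    using shallow_le_layer by blast
  obtain D where D: "D \<ge> 1" "\<And>x r. 0 \<le> r \<Longrightarrow> V x (2 * r) \<le> D * V x r" using doubling by blast
  obtain J :: nat where J: "C * D / \<eta> < J" using reals_Archimedean2 by blast
  have J0: "real J > 0" using J C D assms by (smt (verit) divide_pos_pos mult_pos_pos)
  have MJ: "M ^ J \<ge> 1" using M by simp
  have "vol wt {z \<in> B x r. z \<notin> K \<and> \<not> deep (1 / M ^ J * r) z} \<le> \<eta> * V x r" if r: "M ^ J \<le> r" for x r
  proof -
    define s where "s = r / M ^ J"
    have s1: "1 \<le> s" using r MJ by (simp add: s_def field_simps)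
    have rs: "r = M ^ J * s" using M by (simp add: s_def)
    define L where "L i = {v \<in> B x (2 * r). deep (M ^ i * s) v \<and> \<not> deep (M ^ Suc i * s) v}" for i
    let ?E = "{z \<in> B x r. z \<notin> K \<and> \<not> deep s z}"
    have le: "vol wt ?E \<le> C * vol wt (L i)" if i: "i < J" for i
    proof -
      have Mi: "1 \<le> M ^ i" using M by simp
      have s_le: "s \<le> M ^ i * s" using Mi s1 by simp
      have "vol wt ?E \<le> vol wt {z \<in> B x r. z \<notin> K \<and> \<not> deep (M ^ i * s) z}"
        by (rule vol_mono) (auto dest: deep_mono[OF _ s_le])
      also have "\<dots> \<le> C * vol wt {v \<in> B x (2 * r). deep (M ^ i * s) v \<and> \<not> deep (M * (M ^ i * s)) v}"
      proof (rule layer)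
        show "1 \<le> M ^ i * s" using s_le s1 by linarith
        have "M ^ Suc i \<le> M ^ J" by (rule power_increasing) (use i M in auto)
        then show "M * (M ^ i * s) \<le> r" unfolding rs using s1 by (simp add: mult.assoc[symmetric])
      qed
      finally show ?thesis by (simp add: L_def mult.assoc)
    qed
    have "real J * vol wt ?E = (\<Sum>i<J. vol wt ?E)" by simp
    also have "\<dots> \<le> (\<Sum>i<J. C * vol wt (L i))" by (rule sum_mono) (use le in simp)
    also have "\<dots> = C * (\<Sum>i<J. vol wt (L i))" by (simp add: sum_distrib_left)
    also have "(\<Sum>i<J. vol wt (L i)) = vol wt (\<Union>i<J. L i)"
      unfolding vol_def
    proof (rule sum.UNION_disjoint[symmetric])
      have disj: "L i \<inter> L j = {}" if "i < j" for i j
      proof -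
        have "M ^ Suc i \<le> M ^ j" by (rule power_increasing) (use that M in auto)
        then have "M ^ Suc i * s \<le> M ^ j * s" using s1 by (intro mult_right_mono) auto
        then show ?thesis unfolding L_def using deep_mono by blast
      qed
      then show "\<forall>i\<in>{..<J}. \<forall>j\<in>{..<J}. i \<noteq> j \<longrightarrow> L i \<inter> L j = {}"
        by (metis Int_commute linorder_neqE_nat)
    qed (auto simp: L_def)
    also have "C * \<dots> \<le> C * V x (2 * r)"
      by (intro mult_left_mono vol_mono) (use C in \<open>auto simp: L_def\<close>)
    also have "\<dots> \<le> C * (D * V x r)"
      by (intro mult_left_mono D(2)) (use C MJ r in auto)
    also have "\<dots> = (C * D) * V x r" by simp
    also have "\<dots> \<le> (real J * \<eta>) * V x r"
      by (rule mult_right_mono) (use J assms in \<open>auto simp: field_simps\<close>)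
    finally have "real J * vol wt ?E \<le> real J * (\<eta> * V x r)" by (simp add: mult.assoc)
    then have "vol wt ?E \<le> \<eta> * V x r" using J0 by (simp only: mult_le_cancel_left_pos)
    then show ?thesis by (simp add: s_def)
  qed
  then show ?thesis using MJ by (intro exI[of _ "1 / M ^ J"] exI[of _ "M ^ J"]) auto
qed

definition core :: "real \<Rightarrow> real \<Rightarrow> nat \<Rightarrow> 'a \<Rightarrow> 'a set" where
  "core \<Lambda> \<delta> n x = {w. w \<notin> K \<and> real (dI x w) \<le> \<Lambda> * sqrt n \<and> deep (\<delta> * sqrt n) w}"

lemma core_probability:
  assumes "\<epsilon> > 0" and alive: "\<And>x n. x \<notin> K \<Longrightarrow> \<epsilon> \<le> alive n x"
  shows "\<exists>\<Lambda> \<delta> n0. \<Lambda> \<ge> 1 \<and> \<delta> > 0 \<and> (\<forall>x n. x \<notin> K \<longrightarrow> n0 \<le> n \<longrightarrow>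
    \<epsilon> / 2 \<le> killed (-K) n (indicator (core \<Lambda> \<delta> n x)) x)"
proof -
  obtain C c where C: "C \<ge> 1" and c: "c > 0"
    and tail: "\<And>x n R. x \<notin> K \<Longrightarrow> n \<ge> 1 \<Longrightarrow> 0 \<le> R \<Longrightarrow>
     killed (-K) n (indicator {w. R < real (dI x w)}) x \<le> C * exp (- c * R\<^sup>2 / n)"
    using inner_tail by blast
  define X where "X = max 1 (ln (4 * C / \<epsilon>) / c)"
  define \<Lambda> where "\<Lambda> = sqrt X"
  have \<Lambda>: "\<Lambda> \<ge> 1" "\<Lambda>\<^sup>2 = X" by (auto simp: \<Lambda>_def X_def)
  have "ln (4 * C / \<epsilon>) \<le> c * X" using c unfolding X_def by (simp add: max_def field_simps)
  then have "4 * C / \<epsilon> \<le> exp (c * X)" using C assms(1) by (metis divide_pos_pos exp_le_cancel_iff exp_ln less_le_trans mult_pos_pos zero_less_numeral zero_less_one)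
  then have small: "C * exp (- c * X) \<le> \<epsilon> / 4" using assms(1) by (simp add: exp_minus field_simps)
  obtain D where D: "D \<ge> 1" "\<And>x r. 0 \<le> r \<Longrightarrow> V x (\<Lambda> * r) \<le> D * V x r"
    using doubling_mult by blast
  define \<eta> where "\<eta> = \<epsilon> / (4 * c3 * D)"
  have \<eta>: "\<eta> > 0" using assms(1) c_pos D by (simp add: \<eta>_def)
  obtain \<delta> r0 where \<delta>: "\<delta> > 0"
    and sv: "\<And>x r. r0 \<le> r \<Longrightarrow> vol wt {z \<in> B x r. z \<notin> K \<and> \<not> deep (\<delta> * r) z} \<le> \<eta> * V x r"
    using shallow_volume[OF \<eta>] by blast
  obtain n0 :: nat where n0: "r0\<^sup>2 + 1 \<le> n0" using real_arch_simple by blast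
  have "\<epsilon> / 2 \<le> killed (-K) n (indicator (core \<Lambda> (\<delta> * \<Lambda>) n x)) x" if x: "x \<notin> K" and n: "n0 \<le> n" for x n
  proof -
    have n': "r0\<^sup>2 + 1 \<le> real n" using n n0 by linarith
    then have n1: "n \<ge> 1" by (smt (verit) of_nat_1 of_nat_le_iff zero_le_power2)
    define r where "r = \<Lambda> * sqrt n"
    have "r0 \<le> sqrt n" by (rule real_le_rsqrt) (use n' in simp)
    also have "\<dots> \<le> r" unfolding r_def using \<Lambda> by (simp add: mult_le_cancel_right1)
    finally have r0: "r0 \<le> r" .
    have r_nonneg: "0 \<le> r" unfolding r_def using \<Lambda> by simp
    let ?E = "{z \<in> B x r. z \<notin> K \<and> \<not> deep (\<delta> * r) z}"
    let ?F = "{w. r < real (dI x w)}"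
    let ?I = "core \<Lambda> (\<delta> * \<Lambda>) n x"
    have "\<epsilon> \<le> alive n x" by (rule alive[OF x])
    also have "\<dots> \<le> killed (-K) n (\<lambda>w. (indicator ?I w + indicator ?F w) + indicator ?E w) x"
    proof (rule killed_mono)
      fix w assume w: "w \<in> - K"
      then have "d x w \<le> dI x w" using d_le_dI x by simp
      then have "w \<in> ?I \<or> w \<in> ?F \<or> w \<in> ?E"
        using w by (auto simp: core_def r_def mult.assoc)
      then show "1 \<le> (indicator ?I w + indicator ?F w) + (indicator ?E w :: real)"
        by (auto simp: indicator_def)
    qed
    also have "\<dots> = killed (-K) n (indicator ?I) x + killed (-K) n (indicator ?F) x
        + killed (-K) n (indicator ?E) x" by (simp only: killed_add)
    also have "killed (-K) n (indicator ?F) x \<le> \<epsilon> / 4"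
    proof -
      have "killed (-K) n (indicator ?F) x \<le> C * exp (- c * r\<^sup>2 / n)"
        by (rule tail[OF x n1 r_nonneg])
      also have "- c * r\<^sup>2 / n = - c * X" using n1 \<Lambda> by (simp add: r_def power_mult_distrib)
      finally show ?thesis using small by linarith
    qed
    also have "killed (-K) n (indicator ?E) x \<le> \<epsilon> / 4"
    proof -
      have Vp: "V x (sqrt n) > 0" by (rule V_pos) simp
      have "killed (-K) n (indicator ?E) x \<le> c3 * vol wt ?E / V x (sqrt n)"
        by (rule killed_indicator_le) auto
      also have "\<dots> \<le> c3 * (\<eta> * (D * V x (sqrt n))) / V x (sqrt n)"
      proof (intro divide_right_mono mult_left_mono)
        have "vol wt ?E \<le> \<eta> * V x r" by (rule sv[OF r0])
        also have "\<dots> \<le> \<eta> * (D * V x (sqrt n))"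
          unfolding r_def by (intro mult_left_mono D(2)) (use \<eta> in auto)
        finally show "vol wt ?E \<le> \<eta> * (D * V x (sqrt n))" .
      qed (use c_pos in auto)
      also have "\<dots> = \<epsilon> / 4" using Vp c_pos D by (simp add: \<eta>_def)
      finally show ?thesis .
    qed
    finally show ?thesis by simp
  qed
  moreover have "\<delta> * \<Lambda> > 0" using \<delta> \<Lambda> by simp
  ultimately show ?thesis using \<Lambda>(1) by blast
qed


lemma near_diagonal_lower:
  "\<exists>\<beta> c. 0 < \<beta> \<and> \<beta> \<le> 1 \<and> c > 0 \<and> (\<forall>u v m s. 1 \<le> m \<longrightarrow> 0 \<le> s \<longrightarrow> real m \<le> \<beta> * s\<^sup>2 \<longrightarrow> deep s v \<longrightarrow>
     real (d u v) \<le> sqrt m \<longrightarrow> c * wt v / V v (sqrt m) \<le> q (-K) m u v)"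
proof -
  have "1 / (2 * c4) > 0" using c_pos by simp
  then obtain C1 where C1: "C1 \<ge> 1" and Vexp: "\<And>x n r. n \<ge> 1 \<Longrightarrow> 0 \<le> r \<Longrightarrow> r \<le> real n \<Longrightarrow>
    V x r \<le> C1 * exp (1 / (2 * c4) * r\<^sup>2 / n) * V x (sqrt n)"
    using V_exp by blast
  define c where "c = c1 * exp (- 1 / c2) / 2"
  have c: "c > 0" using c_pos by (simp add: c_def)
  define X where "X = max 1 (- ln (c / (c3 * C1)))"
  have X: "X \<ge> 1" "- X \<le> ln (c / (c3 * C1))" by (auto simp: X_def)
  have "exp (- X) \<le> exp (ln (c / (c3 * C1)))" using X(2) by simp
  also have "\<dots> = c / (c3 * C1)" using c C1 c_pos by (intro exp_ln) simp
  finally have expX: "c3 * C1 * exp (- X) \<le> c" using C1 c_pos by (simp add: field_simps)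
  define \<beta> where "\<beta> = min 1 (1 / (2 * c4 * X))"
  have \<beta>: "0 < \<beta>" "\<beta> \<le> 1" "\<beta> \<le> 1 / (2 * c4 * X)" using X c_pos by (auto simp: \<beta>_def)
  have "c * wt v / V v (sqrt m) \<le> q (-K) m u v"
    if m: "1 \<le> m" and s0: "0 \<le> s" and ms: "real m \<le> \<beta> * s\<^sup>2" and dv: "deep s v" and uv: "real (d u v) \<le> sqrt m"
    for u v m s
  proof -
    have Vp: "V v (sqrt n) > 0" for n :: nat by (rule V_pos) simp
    have spos: "s > 0"
    proof (rule ccontr)
      assume "\<not> s > 0"
      then have "s = 0" using s0 by simp
      then show False using ms m by simp
    qed
    have "\<beta> * s\<^sup>2 \<le> 1 * s\<^sup>2" using \<beta> by (intro mult_right_mono) auto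
    then have "real m \<le> s\<^sup>2" using ms by linarith
    then have ms': "sqrt m \<le> s" using s0 by (simp add: real_le_lsqrt)
    have Xs: "X \<le> s\<^sup>2 / (2 * c4 * t)" if t: "t \<le> m" "0 < t" for t :: nat
    proof -
      have "real t \<le> \<beta> * s\<^sup>2" using t ms by linarith
      also have "\<dots> \<le> 1 / (2 * c4 * X) * s\<^sup>2" using \<beta> by (intro mult_right_mono) auto
      finally show ?thesis using t X c_pos by (simp add: field_simps)
    qed
    define a where "a = c * wt v / V v (sqrt m)"
    have a0: "0 \<le> a" using c by (simp add: a_def)
    have bound: "q UNIV t z v \<le> a" if t: "t \<le> m" and z: "z \<in> K" for t z
    proof (cases "t < d z v")
      case True
      then show ?thesis using a0 by (simp add: q_zero)
    next
      case False
      have sd: "s \<le> real (d z v)" using dv z d_commute[of z v] by (simp add: deep_def)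
      then have st: "s \<le> real t" using False by linarith
      then have t0: "0 < t" using spos by (cases t) auto
      have "V v (sqrt m) \<le> V v s" by (rule V_mono[OF ms'])
      also have "\<dots> \<le> C1 * exp (1 / (2 * c4) * s\<^sup>2 / t) * V v (sqrt t)"
        by (rule Vexp) (use t0 s0 st in auto)
      finally have "1 / V v (sqrt t) \<le> C1 * exp (1 / (2 * c4) * s\<^sup>2 / t) / V v (sqrt m)"
        using Vp by (simp add: field_simps)
      then have V1: "1 / V v (sqrt t) \<le> C1 * exp (s\<^sup>2 / (2 * c4 * t)) / V v (sqrt m)" by simp
      have "s\<^sup>2 / (c4 * t) \<le> (real (d z v))\<^sup>2 / (c4 * t)"
        by (intro divide_right_mono power_mono) (use sd s0 c_pos in auto)
      then have e1: "exp (- (real (d z v))\<^sup>2 / (c4 * t)) \<le> exp (- (s\<^sup>2 / (c4 * t)))" by simp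
      have "q UNIV t z v \<le> wt v * (c3 / V v (sqrt t) * exp (- (real (d z v))\<^sup>2 / (c4 * t)))"
        by (rule q_upper_sym)
      also have "\<dots> = wt v * c3 * (1 / V v (sqrt t) * exp (- (real (d z v))\<^sup>2 / (c4 * t)))" by simp
      also have "\<dots> \<le> wt v * c3 * (C1 * exp (s\<^sup>2 / (2 * c4 * t)) / V v (sqrt m) * exp (- (s\<^sup>2 / (c4 * t))))"
        by (intro mult_left_mono mult_mono V1 e1) (use c_pos C1 in auto)
      also have "\<dots> = wt v / V v (sqrt m) * (c3 * C1 * (exp (s\<^sup>2 / (2 * c4 * t)) * exp (- (s\<^sup>2 / (c4 * t)))))"
        by simp
      also have "exp (s\<^sup>2 / (2 * c4 * t)) * exp (- (s\<^sup>2 / (c4 * t))) = exp (- (s\<^sup>2 / (2 * c4 * t)))"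
        unfolding exp_add[symmetric] using c_pos t0 by (simp add: field_simps)
      also have "wt v / V v (sqrt m) * (c3 * C1 * exp (- (s\<^sup>2 / (2 * c4 * t))))
          \<le> wt v / V v (sqrt m) * (c3 * C1 * exp (- X))"
        by (intro mult_left_mono) (use Xs[OF t t0] c_pos C1 in auto)
      also have "\<dots> \<le> wt v / V v (sqrt m) * c"
        by (rule mult_left_mono[OF expX]) simp
      finally show ?thesis by (simp add: a_def mult.commute)
    qed
    have "q UNIV m u v \<le> q (-K) m u v + a * hit (- (- K)) m u"
      by (rule killed_le_killed_plus_exit) (use bound in auto)
    moreover have "a * hit (- (- K)) m u \<le> a * 1" by (rule mult_left_mono[OF hit_le_1 a0])
    moreover have "2 * a \<le> q UNIV m u v"
    proof -
      have "(real (d u v))\<^sup>2 \<le> (sqrt m)\<^sup>2" by (rule power_mono[OF uv]) simp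
      then have "(real (d u v))\<^sup>2 / (c2 * m) \<le> m / (c2 * m)"
        using c_pos by (intro divide_right_mono) auto
      also have "\<dots> = 1 / c2" using m by simp
      finally have "exp (- 1 / c2) \<le> exp (- (real (d u v))\<^sup>2 / (c2 * m))" by simp
      then have "wt v * (c1 / V v (sqrt m) * exp (- 1 / c2))
          \<le> wt v * (c1 / V v (sqrt m) * exp (- (real (d u v))\<^sup>2 / (c2 * m)))"
        using c_pos by (intro mult_left_mono) auto
      also have "\<dots> \<le> q UNIV m u v"
      proof (rule q_lower_sym)
        have "sqrt m * 1 \<le> sqrt m * sqrt m" using m by (intro mult_left_mono) auto
        then have "real (d u v) \<le> real m" using uv by simp
        then show "d u v \<le> m" by simp
      qed
      finally show ?thesis by (simp add: a_def c_def mult_ac)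
    qed
    ultimately show ?thesis unfolding a_def by linarith
  qed
  with \<beta> c show ?thesis by blast
qed

lemma chain_lower:
  assumes near: "\<And>u v. deep s v \<Longrightarrow> real (d u v) \<le> a \<Longrightarrow> c * wt v / V v a \<le> q (-K) m u v"
    and c: "c > 0" and a: "a \<ge> 0" and D: "D \<ge> 1"
    and dbl: "\<And>x y. real (d x y) \<le> a \<Longrightarrow> V x a \<le> D * V y (a / 3)"
    and p: "\<And>i. deep (s + a / 3) (p i)" "\<And>i. real (d (p i) (p (Suc i))) \<le> a / 3"
  shows "real (d (p (Suc i)) v) \<le> a / 3 \<Longrightarrow>
    (c / D) ^ Suc i * wt v / V (p 0) a \<le> q (-K) (Suc i * m) (p 0) v"
proof (induction i arbitrary: v)
  case 0
  have Vp: "V (p 0) a > 0" "V v a > 0" using a by (auto intro: V_pos)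
  have dist: "real (d (p 0) v) \<le> a"
    using d_triangle[of "p 0" v "p 1"] p(2)[of 0] 0 a by simp
  have dv: "deep s v" by (rule deep_translate[OF p(1)[of 1]]) (use 0 in simp)
  have "V v a \<le> D * V (p 0) (a / 3)" by (rule dbl) (use dist d_commute[of v "p 0"] in simp)
  also have "\<dots> \<le> D * V (p 0) a" by (intro mult_left_mono V_mono) (use a D in auto)
  finally have "1 / (D * V (p 0) a) \<le> 1 / V v a" using Vp D by (intro divide_left_mono) auto
  then have "c * wt v * (1 / (D * V (p 0) a)) \<le> c * wt v * (1 / V v a)"
    by (rule mult_left_mono) (use c in simp)
  also have "\<dots> \<le> q (-K) m (p 0) v" using near[OF dv dist] by simp
  finally show ?case by simp
next
  case (Suc i)
  let ?x = "p 0" and ?u = "p (Suc i)" and ?\<gamma> = "(c / D) ^ Suc i"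
  have Vp: "V ?x a > 0" "V v a > 0" "V ?u (a / 3) > 0" using a by (auto intro: V_pos)
  have \<gamma>: "?\<gamma> > 0" using c D by simp
  have dv: "deep s v" by (rule deep_translate[OF p(1)[of "Suc (Suc i)"]]) (use Suc.prems in simp)
  have duv: "real (d ?u v) \<le> 2 / 3 * a"
    using d_triangle[of ?u v "p (Suc (Suc i))"] p(2)[of "Suc i"] Suc.prems by simp
  have "V v a \<le> D * V ?u (a / 3)" by (rule dbl) (use duv d_commute[of v ?u] a in simp)
  then have frac: "1 / D \<le> V ?u (a / 3) / V v a" using Vp D by (simp add: field_simps)
  have "(c / D) ^ Suc (Suc i) * wt v / V ?x a = ?\<gamma> / V ?x a * (c * wt v) * (1 / D)" by (simp add: mult_ac)
  also have "\<dots> \<le> ?\<gamma> / V ?x a * (c * wt v) * (V ?u (a / 3) / V v a)"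
    by (rule mult_left_mono[OF frac], intro mult_nonneg_nonneg divide_nonneg_nonneg less_imp_le[OF \<gamma>])
      (use c in auto)
  also have "\<dots> = (\<Sum>y\<in>B ?u (a / 3). (?\<gamma> * wt y / V ?x a) * (c * wt v / V v a))"
    by (simp add: vol_def sum_distrib_left sum_distrib_right sum_divide_distrib mult_ac)
  also have "\<dots> \<le> (\<Sum>y\<in>B ?u (a / 3). q (-K) (Suc i * m) ?x y * q (-K) m y v)"
  proof (intro sum_mono mult_mono)
    fix y assume y: "y \<in> B ?u (a / 3)"
    then show "?\<gamma> * wt y / V ?x a \<le> q (-K) (Suc i * m) ?x y" by (intro Suc.IH) simp
    have "real (d y v) \<le> a"
      using d_triangle[of y v ?u] d_commute[of y ?u] duv y by simp
    then show "c * wt v / V v a \<le> q (-K) m y v" by (rule near[OF dv])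
  qed (use c in auto)
  also have "\<dots> \<le> q (-K) (Suc i * m + m) ?x v" by (rule q_Chapman_ge) simp
  also have "Suc i * m + m = Suc (Suc i) * m" by simp
  finally show ?case .
qed

lemma core_lower:
  assumes \<Lambda>: "\<Lambda> \<ge> 1" and \<delta>: "\<delta> > 0"
  shows "\<exists>\<beta> J c n0. \<beta> > 0 \<and> c > 0 \<and> (\<forall>n z w. n0 \<le> n \<longrightarrow> deep (\<delta> * sqrt (real n)) z \<longrightarrow>
     deep (\<delta> * sqrt (real n)) w \<longrightarrow> real (dI z w) \<le> \<Lambda> * sqrt (real n) \<longrightarrow>
     c * wt w / V z (sqrt (real n)) \<le> q (-K) (J * nat \<lfloor>\<beta> * real n\<rfloor>) z w)"
proof -
  obtain \<beta>0 c where \<beta>0: "0 < \<beta>0" "\<beta>0 \<le> 1" and c: "c > 0"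
    and near: "\<And>u v m s. 1 \<le> m \<Longrightarrow> 0 \<le> s \<Longrightarrow> real m \<le> \<beta>0 * s\<^sup>2 \<Longrightarrow> deep s v \<Longrightarrow>
     real (d u v) \<le> sqrt (real m) \<Longrightarrow> c * wt v / V v (sqrt (real m)) \<le> q (-K) m u v"
    using near_diagonal_lower by blast
  obtain D where D: "D \<ge> 1"
    "\<And>x y r. 0 \<le> r \<Longrightarrow> real (d x y) \<le> 3 * r \<Longrightarrow> V x (3 * r) \<le> D * V y r"
    using doubling_translate[of 3] by blast
  define \<delta>1 where "\<delta>1 = min (\<delta> / 2) (cu * \<delta> / 2)"
  define \<delta>2 where "\<delta>2 = min 1 (\<delta>1 / 2)"
  have \<delta>1: "\<delta>1 > 0" "\<delta>1 \<le> \<delta> / 2" "\<delta>1 \<le> cu * \<delta> / 2" using \<delta> cu_pos by (auto simp: \<delta>1_def)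
  have \<delta>2: "\<delta>2 > 0" "\<delta>2 \<le> 1" "\<delta>2 \<le> \<delta>1 / 2" using \<delta>1 by (auto simp: \<delta>2_def)
  define \<beta> where "\<beta> = \<beta>0 * \<delta>2\<^sup>2"
  have \<beta>: "\<beta> > 0" using \<beta>0 \<delta>2 by (simp add: \<beta>_def)
  have "\<beta> \<le> 1 * \<delta>2\<^sup>2" unfolding \<beta>_def by (rule mult_right_mono) (use \<beta>0 in auto)
  then have \<beta>\<delta>: "\<beta> \<le> \<delta>2\<^sup>2" by simp
  obtain J' :: nat where J': "6 * CU * \<Lambda> / sqrt (\<beta> / 2) \<le> J'" using real_arch_simple by blast
  define J where "J = Suc J'"
  have J: "6 * CU * \<Lambda> / sqrt (\<beta> / 2) \<le> J" using J' by (simp add: J_def)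
  obtain n0 :: nat where n0: "10 / \<beta> \<le> n0" using real_arch_simple by blast
  have "(c / D) ^ J * wt w / V z (sqrt (real n)) \<le> q (-K) (J * nat \<lfloor>\<beta> * real n\<rfloor>) z w"
    if n: "n0 \<le> n" and z: "deep (\<delta> * sqrt (real n)) z" and w: "deep (\<delta> * sqrt (real n)) w"
      and zw: "real (dI z w) \<le> \<Lambda> * sqrt (real n)" for n z w
  proof -
    define R where "R = sqrt (real n)"
    have "10 / \<beta> \<le> real n" using n n0 by linarith
    then have bn: "10 \<le> \<beta> * real n" using \<beta> by (simp add: field_simps)
    have "n \<noteq> 0" using bn by (intro notI) simp
    then have n_pos: "real n > 0" by simp
    have R: "R > 0" "R\<^sup>2 = real n" using n_pos by (auto simp: R_def)
    define m where "m = nat \<lfloor>\<beta> * real n\<rfloor>"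
    have m: "real m \<le> \<beta> * real n" "\<beta> * real n < real m + 1" unfolding m_def using bn by linarith+
    have m9: "9 \<le> m" using m bn by linarith
    have m2: "\<beta> / 2 * real n \<le> real m" using m bn by simp
    define a where "a = sqrt (real m)"
    have "(3::real) \<le> a" unfolding a_def by (rule real_le_rsqrt) (use m9 in simp)
    have "real m \<le> (\<delta>2 * R)\<^sup>2"
    proof -
      have "\<beta> * real n \<le> \<delta>2\<^sup>2 * real n" by (rule mult_right_mono[OF \<beta>\<delta>]) simp
      then show ?thesis using m R by (simp add: power_mult_distrib)
    qed
    then have a_le: "a \<le> \<delta>2 * R" unfolding a_def using \<delta>2 R by (intro real_le_lsqrt) auto
    have a_le_R: "a \<le> R"
    proof -
      have "\<delta>2 * R \<le> 1 * R" using \<delta>2 R by (intro mult_right_mono) auto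
      then show ?thesis using a_le by simp
    qed
    have a_ge: "sqrt (\<beta> / 2) * R \<le> a"
      unfolding a_def R_def real_sqrt_mult[symmetric] using m2 by simp
    define t where "t = nat \<lfloor>a / 3\<rfloor>"
    have t: "real t \<le> a / 3" "a / 3 < real t + 1" unfolding t_def using \<open>3 \<le> a\<close> by linarith+
    have "real t > 0" using t \<open>3 \<le> a\<close> by linarith
    then have "1 \<le> real t" by simp
    then have t6: "a / 6 \<le> real t" using t by linarith
    have pos: "\<delta> * sqrt (real n) > 0" using \<delta> n_pos by simp
    have zK: "z \<notin> K" and wK: "w \<notin> K" using deep_notin[OF z pos] deep_notin[OF w pos] by auto
    obtain xs where xs: "walk adjI xs" "hd xs = z" "last xs = w"
        "real (length xs - 1) \<le> CU * real (dI z w)"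
      and xsd: "\<forall>j < length xs. \<forall>v\<in>outer_bdry K adj.
            cu * (1 + real (min j (length xs - 1 - j))) \<le> real (d (xs ! j) v)"
      using inner_uniform_walk[OF zK wK] by blast
    define k where "k = length xs - 1"
    have ne: "xs \<noteq> []" using xs(1) by (simp add: walk_def)
    have len: "length xs = Suc k" using ne by (simp add: k_def)
    have x0: "xs ! 0 = z" and xk: "xs ! k = w"
      using xs ne by (auto simp: hd_conv_nth last_conv_nth k_def)
    have dist: "d (xs ! i) (xs ! j) \<le> j - i" if "i \<le> j" "j \<le> k" for i j
    proof -
      have "(adjI ^^ (j - i)) (xs ! i) (xs ! j)" using walk_nth_relpowp[OF xs(1)] that len by simp
      then have "(adj ^^ (j - i)) (xs ! i) (xs ! j)" by (rule relpowp_mono[rotated]) (simp add: adjG_def)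
      then show ?thesis by (rule gdist_le)
    qed
    have xK: "xs ! j \<notin> K" if "j \<le> k" for j
    proof -
      have "(adjI ^^ j) (xs ! 0) (xs ! j)" using walk_nth_relpowp[OF xs(1), of 0 j] that len by simp
      then show ?thesis using adjI_relpowp_notin x0 zK by metis
    qed
    have deep_xs: "deep (\<delta>1 * R) (xs ! j)" if j: "j \<le> k" for j
    proof -
      have d1: "\<delta>1 * R \<le> \<delta> / 2 * R" using \<delta>1 R by (intro mult_right_mono) auto
      consider "real j \<le> \<delta> / 2 * R" | "real (k - j) \<le> \<delta> / 2 * R"
        | "\<delta> / 2 * R < real j" "\<delta> / 2 * R < real (k - j)" by linarith
      then show ?thesis
      proof cases
        case 1
        have "real (d z (xs ! j)) \<le> real j" using dist[of 0 j] j x0 by simp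
        then show ?thesis using d1 1 by (intro deep_translate[OF z]) (simp add: R_def)
      next
        case 2
        have "real (d w (xs ! j)) \<le> real (k - j)" using dist[of j k] j xk d_commute by simp
        then show ?thesis using d1 2 by (intro deep_translate[OF w]) (simp add: R_def)
      next
        case 3
        then have "\<delta> / 2 * R \<le> 1 + real (min j (k - j))" by (simp add: min_def)
        then have "cu * (\<delta> / 2 * R) \<le> cu * (1 + real (min j (k - j)))"
          using cu_pos by (intro mult_left_mono) auto
        moreover have "\<delta>1 * R \<le> cu * \<delta> / 2 * R" using \<delta>1 R by (intro mult_right_mono) auto
        ultimately have le: "\<delta>1 * R \<le> cu * (1 + real (min j (k - j)))" by simp
        have "deep (cu * (1 + real (min j (k - j)))) (xs ! j)"
        proof (rule deep_bdry[OF xK[OF j]], rule ballI)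
          fix v assume "v \<in> outer_bdry K adj"
          moreover have "j < length xs" using j len by linarith
          ultimately show "cu * (1 + real (min j (k - j))) \<le> real (d (xs ! j) v)"
            using xsd unfolding k_def by blast
        qed
        then show ?thesis by (rule deep_mono[OF _ le])
      qed
    qed
    define p where "p i = xs ! (min (i * t) k)" for i
    have p0: "p 0 = z" by (simp add: p_def x0)
    have pJ: "p J = w"
    proof -
      have "real k \<le> CU * (\<Lambda> * R)"
        using xs(4) mult_left_mono[OF zw, of CU] CU_pos unfolding k_def R_def by linarith
      also have "\<dots> = 6 * CU * \<Lambda> / sqrt (\<beta> / 2) * (sqrt (\<beta> / 2) * R / 6)" using \<beta> by simp
      also have "\<dots> \<le> real J * real t"
      proof (rule mult_mono)
        show "sqrt (\<beta> / 2) * R / 6 \<le> real t" using a_ge t6 by linarith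
      qed (use J R \<beta> in auto)
      finally have "real k \<le> real (J * t)" by simp
      then have "k \<le> J * t" by (simp only: of_nat_le_iff)
      then show ?thesis by (simp add: p_def min_def xk)
    qed
    have Rs: "\<delta>2 * R + a / 3 \<le> \<delta>1 * R"
    proof -
      have "\<delta>2 * R \<le> \<delta>1 / 2 * R" using \<delta>2 R by (intro mult_right_mono) auto
      then show ?thesis using a_le \<open>3 \<le> a\<close> by linarith
    qed
    have "real (d (p (Suc J')) w) \<le> a / 3" using pJ \<open>3 \<le> a\<close> by (simp add: J_def)
    then have "(c / D) ^ Suc J' * wt w / V (p 0) a \<le> q (-K) (Suc J' * m) (p 0) w"
    proof (rule chain_lower[where s = "\<delta>2 * R", rotated -1])
      show "c * wt v / V v a \<le> q (-K) m u v" if "deep (\<delta>2 * R) v" "real (d u v) \<le> a" for u v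
        unfolding a_def
      proof (rule near)
        have "\<beta>0 * (\<delta>2 * R)\<^sup>2 = \<beta> * real n" using R by (simp add: \<beta>_def power_mult_distrib)
        then show "real m \<le> \<beta>0 * (\<delta>2 * R)\<^sup>2" using m by simp
      qed (use that m9 \<delta>2 R in \<open>auto simp: a_def\<close>)
      show "V x a \<le> D * V y (a / 3)" if "real (d x y) \<le> a" for x y
        using D(2)[of "a / 3" x y] that \<open>3 \<le> a\<close> by simp
      show "deep (\<delta>2 * R + a / 3) (p i)" for i
        unfolding p_def by (rule deep_mono[OF deep_xs Rs]) simp
      show "real (d (p i) (p (Suc i))) \<le> a / 3" for i
      proof -
        have "d (p i) (p (Suc i)) \<le> min (Suc i * t) k - min (i * t) k"
          unfolding p_def by (rule dist) (auto simp: min_def)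
        also have "\<dots> \<le> t" by (auto simp: min_def)
        finally show ?thesis using t by linarith
      qed
    qed (use c D \<open>3 \<le> a\<close> in auto)
    then have low: "(c / D) ^ J * wt w / V z a \<le> q (-K) (J * m) z w" by (simp only: J_def p0)
    have "(c / D) ^ J * wt w / V z R \<le> (c / D) ^ J * wt w / V z a"
    proof (rule divide_left_mono)
      have "V z R > 0" "V z a > 0" using R \<open>3 \<le> a\<close> by (auto intro!: V_pos)
      then show "0 < V z R * V z a" by simp
    qed (use V_mono[OF a_le_R] c D in auto)
    with low show ?thesis by (simp add: R_def m_def)
  qed
  moreover have "(c / D) ^ J > 0" using c D by simp
  ultimately show ?thesis using \<beta> by blast
qed

lemma boundary_occupation_lower:
  assumes "\<epsilon> > 0" and alive: "\<And>x n. x \<notin> K \<Longrightarrow> \<epsilon> \<le> alive n x"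
  shows "\<exists>\<beta> J c n0. \<beta> > 0 \<and> c > 0 \<and> (\<forall>x n. x \<notin> K \<longrightarrow> n0 \<le> n \<longrightarrow>
     c * (VI K adj wt x (sqrt (real n)) / VG K adj wt x (sqrt (real n)))
       \<le> killed (-K) (n + (J * nat \<lfloor>\<beta> * real n\<rfloor> + n)) (indicator A) x)"
proof -
  obtain \<Lambda> \<delta> n1 where \<Lambda>: "\<Lambda> \<ge> 1" and \<delta>: "\<delta> > 0"
    and core: "\<And>x n. x \<notin> K \<Longrightarrow> n1 \<le> n \<Longrightarrow> \<epsilon> / 2 \<le> killed (-K) n (indicator (core \<Lambda> \<delta> n x)) x"
    using core_probability[OF assms] by blast
  have "2 * \<Lambda> + 1 \<ge> 1" using \<Lambda> by simp
  from core_lower[OF this \<delta>] obtain \<beta> J \<gamma> n2 where \<beta>: "\<beta> > 0" and \<gamma>: "\<gamma> > 0" and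
    low: "\<And>n z w. n2 \<le> n \<Longrightarrow> deep (\<delta> * sqrt (real n)) z \<Longrightarrow>
     deep (\<delta> * sqrt (real n)) w \<Longrightarrow> real (dI z w) \<le> (2 * \<Lambda> + 1) * sqrt (real n) \<Longrightarrow>
     \<gamma> * wt w / V z (sqrt (real n)) \<le> q (-K) (J * nat \<lfloor>\<beta> * real n\<rfloor>) z w"
    by blast
  obtain D where D: "D \<ge> 1"
    "\<And>x y r. 0 \<le> r \<Longrightarrow> real (d x y) \<le> \<Lambda> * r \<Longrightarrow> V x (\<Lambda> * r) \<le> D * V y r"
    using doubling_translate[of \<Lambda>] by blast
  obtain c where c: "c > 0" "\<And>x r. x \<notin> K \<Longrightarrow> 0 \<le> r \<Longrightarrow> c * V x r \<le> VG K adj wt x r"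
    using VG_ge by blast
  define \<gamma>' where "\<gamma>' = \<gamma> * (\<epsilon> / 2) * (c / D)"
  have \<gamma>': "\<gamma>' > 0" using \<gamma> c D assms(1) by (simp add: \<gamma>'_def)
  have "\<gamma>' * (\<epsilon> / 2) * (VI K adj wt x (sqrt (real n)) / VG K adj wt x (sqrt (real n)))
       \<le> killed (-K) (n + (J * nat \<lfloor>\<beta> * real n\<rfloor> + n)) (indicator A) x"
    if x: "x \<notin> K" and n: "max n1 n2 \<le> n" for x n
  proof -
    define R where "R = sqrt (real n)"
    have R0: "R \<ge> 0" by (simp add: R_def)
    define T where "T = J * nat \<lfloor>\<beta> * real n\<rfloor>"
    define Y where "Y = ballG K adj x R \<inter> A"
    have finY: "finite Y" unfolding Y_def using finite_ballG[OF x] by blast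
    have YK: "y \<notin> K" "real (dI x y) \<le> R" if "y \<in> Y" for y using that by (auto simp: Y_def ballG_def)
    define I where "I = core \<Lambda> \<delta> n"
    have IK: "w \<notin> K" "real (dI u w) \<le> \<Lambda> * R" "deep (\<delta> * R) w" if "w \<in> I u" for u w
      using that by (auto simp: I_def core_def R_def)
    have finI: "finite (I u)" if "u \<notin> K" for u
    proof (rule finite_subset[OF _ finite_ball])
      show "I u \<subseteq> B u (\<Lambda> * R)" using d_le_dI[OF that] IK by force
    qed
    have VGp: "VG K adj wt x R > 0" by (rule VG_pos[OF x R0])
    have Vxp: "V x R > 0" by (rule V_pos[OF R0])
    have one_y: "\<gamma> * (\<epsilon> / 2) * wt y / V z R \<le> q (-K) (T + n) z y" if z: "z \<in> I x" and y: "y \<in> Y" for z y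
    proof -
      have Vz: "V z R > 0" by (rule V_pos[OF R0])
      have "(\<epsilon> / 2) \<le> killed (-K) n (indicator (I y)) y"
        unfolding I_def by (rule core) (use YK[OF y] n in auto)
      also have "\<dots> = (\<Sum>w\<in>I y. q (-K) n y w)"
        by (subst killed_expand_finite[OF finI[OF YK(1)[OF y]]]) (auto simp: indicator_def)
      finally have "\<gamma> * wt y / V z R * (\<epsilon> / 2) \<le> \<gamma> * wt y / V z R * (\<Sum>w\<in>I y. q (-K) n y w)"
        using \<gamma> by (intro mult_left_mono) auto
      also have "\<dots> = (\<Sum>w\<in>I y. \<gamma> / V z R * (wt y * q (-K) n y w))"
        unfolding sum_distrib_left by (intro sum.cong refl) simp
      also have "\<dots> = (\<Sum>w\<in>I y. \<gamma> * wt w / V z R * q (-K) n w y)"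
        by (intro sum.cong refl) (subst q_reversible, simp)
      also have "\<dots> \<le> (\<Sum>w\<in>I y. q (-K) T z w * q (-K) n w y)"
      proof (intro sum_mono mult_right_mono)
        fix w assume w: "w \<in> I y"
        have "dI z w \<le> dI z x + dI x w" "dI x w \<le> dI x y + dI y w"
          by (rule dI_triangle; use IK[OF z] IK[OF w] x YK[OF y] in simp)+
        then have "real (dI z w) \<le> (2 * \<Lambda> + 1) * R"
          using IK(2)[OF z] IK(2)[OF w] YK(2)[OF y] dI_commute[of z x] by (simp add: distrib_right)
        then show "\<gamma> * wt w / V z R \<le> q (-K) T z w"
          unfolding T_def R_def by (intro low) (use n IK[OF z] IK[OF w] in \<open>auto simp: R_def\<close>)
      qed simp
      also have "\<dots> \<le> q (-K) (T + n) z y" by (rule q_Chapman_ge[OF finI[OF YK(1)[OF y]]])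
      finally show ?thesis by (simp add: mult_ac)
    qed
    have from_core: "\<gamma>' * (VI K adj wt x R / VG K adj wt x R) \<le> killed (-K) (T + n) (indicator A) z"
      if z: "z \<in> I x" for z
    proof -
      have Vz: "V z R > 0" by (rule V_pos[OF R0])
      have "d z x \<le> dI z x" by (rule d_le_dI) (use IK[OF z] x in auto)
      then have zx: "real (d z x) \<le> \<Lambda> * R" using IK(2)[OF z] dI_commute[of z x] by linarith
      have "R \<le> \<Lambda> * R" using \<Lambda> R0 by (simp add: mult_le_cancel_right1)
      then have "V z R \<le> V z (\<Lambda> * R)" by (rule V_mono)
      also have "\<dots> \<le> D * V x R" by (rule D(2)[OF R0 zx])
      finally have "c * V z R \<le> D * (c * V x R)" using c by simp
      also have "\<dots> \<le> D * VG K adj wt x R" by (intro mult_left_mono c(2) x R0) (use D in simp)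
      finally have cV: "(c / D) / VG K adj wt x R \<le> 1 / V z R"
        using Vz VGp D by (simp add: field_simps)
      have "\<gamma>' * (VI K adj wt x R / VG K adj wt x R)
          = \<gamma> * (\<epsilon> / 2) * vol wt Y * ((c / D) / VG K adj wt x R)"
        by (simp add: \<gamma>'_def VI_def Y_def mult_ac)
      also have "\<dots> \<le> \<gamma> * (\<epsilon> / 2) * vol wt Y * (1 / V z R)"
        by (rule mult_left_mono[OF cV]) (use \<gamma> assms(1) in simp)
      also have "\<dots> = (\<Sum>y\<in>Y. \<gamma> * (\<epsilon> / 2) * wt y / V z R)"
        by (simp add: vol_def sum_distrib_left sum_divide_distrib)
      also have "\<dots> \<le> (\<Sum>y\<in>Y. q (-K) (T + n) z y)" by (rule sum_mono) (rule one_y[OF z])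
      also have "\<dots> = killed (-K) (T + n) (indicator Y) z"
        by (subst killed_expand_finite[OF finY]) (auto simp: indicator_def)
      also have "\<dots> \<le> killed (-K) (T + n) (indicator A) z"
        by (rule killed_mono) (auto simp: indicator_def Y_def)
      finally show ?thesis .
    qed
    let ?g = "\<gamma>' * (VI K adj wt x R / VG K adj wt x R)"
    have g0: "0 \<le> ?g" using \<gamma>' VGp by (simp add: VI_def)
    have "?g * (\<epsilon> / 2) \<le> ?g * killed (-K) n (indicator (I x)) x"
      unfolding I_def by (intro mult_left_mono core x g0) (use n in simp)
    also have "\<dots> = killed (-K) n (\<lambda>z. ?g * indicator (I x) z) x" by (simp only: killed_cmult)
    also have "\<dots> \<le> killed (-K) n (killed (-K) (T + n) (indicator A)) x"
    proof (rule killed_mono)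
      fix z
      show "?g * indicator (I x) z \<le> killed (-K) (T + n) (indicator A) z"
        using from_core[of z] by (cases "z \<in> I x") (auto intro: killed_nonneg)
    qed
    also have "\<dots> = killed (-K) (n + (T + n)) (indicator A) x" by (simp only: killed_comp[of _ n])
    finally show ?thesis by (simp add: R_def T_def mult_ac)
  qed
  moreover have "\<gamma>' * (\<epsilon> / 2) > 0" using \<gamma>' assms(1) by simp
  ultimately show ?thesis using \<beta> by blast
qed

lemma bdry_sum_bounded_if_transient:
  assumes "unif_S_transient adj mu wt K"
  shows "\<exists>C>0. \<forall>x. x \<notin> K \<longrightarrow> bdry_sum K adj wt x \<le> ennreal C"
proof -
  obtain \<epsilon> where \<epsilon>: "\<epsilon> > 0" "\<And>x n. x \<notin> K \<Longrightarrow> \<epsilon> \<le> alive n x"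
    using alive_ge_everywhere[OF assms] by blast
  from boundary_occupation_lower[OF \<epsilon>] obtain \<beta> J c n0 where \<beta>: "\<beta> > 0" and c: "c > 0" and
    low: "\<And>x n. x \<notin> K \<Longrightarrow> n0 \<le> n \<Longrightarrow>
     c * (VI K adj wt x (sqrt (real n)) / VG K adj wt x (sqrt (real n)))
       \<le> killed (-K) (n + (J * nat \<lfloor>\<beta> * real n\<rfloor> + n)) (indicator A) x"
    by blast
  define \<tau> where "\<tau> n = n + (J * nat \<lfloor>\<beta> * real n\<rfloor> + n)" for n
  have \<tau>_mono: "\<tau> i < \<tau> j" if "i < j" for i j
  proof -
    have "\<beta> * real i \<le> \<beta> * real j" using that \<beta> by (intro mult_left_mono) auto
    then have "nat \<lfloor>\<beta> * real i\<rfloor> \<le> nat \<lfloor>\<beta> * real j\<rfloor>" by (intro nat_mono floor_mono)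
    then have "J * nat \<lfloor>\<beta> * real i\<rfloor> \<le> J * nat \<lfloor>\<beta> * real j\<rfloor>" by (rule mult_le_mono2)
    then show ?thesis using that unfolding \<tau>_def by linarith
  qed
  define C where "C = real n0 + Cc / c"
  have C: "C > 0" using c Cc_pos by (simp add: C_def add_nonneg_pos)
  have "bdry_sum K adj wt x \<le> ennreal C" if x: "x \<notin> K" for x
  proof -
    let ?a = "\<lambda>n. VI K adj wt x (sqrt (real n)) / VG K adj wt x (sqrt (real n))"
    let ?k = "\<lambda>n. killed (-K) n (indicator A) x"
    have k0: "0 \<le> ?k n" for n by (rule killed_nonneg) simp
    have a0: "0 \<le> ?a n" for n by (simp add: VI_def VG_def)
    have a1: "?a n \<le> 1" for n
    proof -
      have "VI K adj wt x (sqrt (real n)) \<le> VG K adj wt x (sqrt (real n))"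
        unfolding VI_def VG_def by (rule vol_mono) (use finite_ballG[OF x] in auto)
      then show ?thesis using VG_pos[OF x, of "sqrt (real n)"] by simp
    qed
    have part: "(\<Sum>n<m. ?a n) \<le> C" for m
    proof -
      have "(\<Sum>n\<in>{..<m} - {..<n0}. ?a n) \<le> (\<Sum>n\<in>{..<m} - {..<n0}. 1 / c * ?k (\<tau> n))"
      proof (rule sum_mono)
        fix n assume "n \<in> {..<m} - {..<n0}"
        then have "c * ?a n \<le> ?k (\<tau> n)" unfolding \<tau>_def by (intro low x) simp
        then show "?a n \<le> 1 / c * ?k (\<tau> n)" using c by (simp add: field_simps)
      qed
      also have "\<dots> = 1 / c * (\<Sum>n\<in>{..<m} - {..<n0}. ?k (\<tau> n))" by (simp only: sum_distrib_left)
      also have "(\<Sum>n\<in>{..<m} - {..<n0}. ?k (\<tau> n)) = (\<Sum>i\<in>\<tau> ` ({..<m} - {..<n0}). ?k i)"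
      proof (subst sum.reindex)
        show "inj_on \<tau> ({..<m} - {..<n0})"
          by (rule inj_onI) (metis \<tau>_mono less_irrefl linorder_neqE_nat)
      qed simp
      also have "1 / c * \<dots> \<le> 1 / c * (\<Sum>i<\<tau> m. ?k i)"
        by (intro mult_left_mono sum_mono2) (use c k0 \<tau>_mono in auto)
      also have "\<dots> \<le> 1 / c * (Cc * 1)"
      proof (rule mult_left_mono)
        have "Cc * hit K (\<tau> m) x \<le> Cc * 1" by (rule mult_left_mono[OF hit_le_1]) (use Cc_pos in simp)
        with green_le_hit[OF x, of "\<tau> m"] show "(\<Sum>i<\<tau> m. ?k i) \<le> Cc * 1" by linarith
      qed (use c in simp)
      finally have big: "(\<Sum>n\<in>{..<m} - {..<n0}. ?a n) \<le> Cc / c" by simp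
      have "(\<Sum>n\<in>{..<m} \<inter> {..<n0}. ?a n) \<le> (\<Sum>n\<in>{..<m} \<inter> {..<n0}. 1)"
        by (rule sum_mono) (rule a1)
      also have "\<dots> \<le> real n0" using card_mono[of "{..<n0}" "{..<m} \<inter> {..<n0}"] by simp
      finally show ?thesis
        using big sum.Int_Diff[of "{..<m}" ?a "{..<n0}"] by (simp add: C_def)
    qed
    have "(\<Sum>n. ennreal (?a n)) \<le> ennreal C"
    proof (rule suminf_le_const)
      show "(\<Sum>n<m. ennreal (?a n)) \<le> ennreal C" for m
        using part[of m] a0 by (subst sum_ennreal) (auto intro: ennreal_leI)
    qed simp
    then show ?thesis by (simp only: bdry_sum_eq[OF x])
  qed
  with C show ?thesis by blast
qed

end

theorem theorem3p15:
  fixes adj :: "'a \<Rightarrow> 'a \<Rightarrow> bool" and mu :: "'a \<Rightarrow> 'a \<Rightarrow> real"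
    and wt :: "'a \<Rightarrow> real" and K :: "'a set"
  assumes "weighted_graph adj mu wt"
    and "harnack_graph adj mu wt"
    and "controlled_weights adj mu wt"
    and "uniformly_lazy adj mu wt"
    and "infinite (- K)"
    and "inner_uniform K adj"
  shows "(unif_S_transient adj mu wt K \<longrightarrow>
            (\<exists>L' \<epsilon>'. L' > 0 \<and> \<epsilon>' > 0 \<and>
               (\<forall>x. x \<notin> K \<longrightarrow> (\<forall>k\<in>K. L' \<le> real (gdist adj x k)) \<longrightarrow>
                  bdry_sum K adj wt x \<le> ennreal \<epsilon>')))
       \<and> ((\<forall>\<epsilon>>0. \<exists>L\<epsilon>>0. \<forall>x. x \<notin> K \<longrightarrow> (\<forall>k\<in>K. L\<epsilon> \<le> real (gdist adj x k)) \<longrightarrow>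
                  bdry_sum K adj wt x \<le> ennreal \<epsilon>)
            \<longrightarrow> unif_S_transient adj mu wt K)"
proof -
  obtain c1 c2 c3 c4 where c: "c1 > 0" "c2 > 0" "c3 > 0" "c4 > 0" and
    heat: "\<forall>n x y. gdist adj x y \<le> n \<longrightarrow>
          c1 / vol wt (gball adj x (sqrt n)) * exp (- (real (gdist adj x y))\<^sup>2 / (c2 * n))
            \<le> heat adj mu wt n x y \<and>
          heat adj mu wt n x y \<le>
          c3 / vol wt (gball adj x (sqrt n)) * exp (- (real (gdist adj x y))\<^sup>2 / (c4 * n))"
    using assms(2) unfolding harnack_graph_def by blast
  obtain Cc where Cc: "Cc > 0" "\<forall>x y. adj x y \<longrightarrow> 1 / Cc \<le> mu x y / wt x"
    using assms(3) unfolding controlled_weights_def by blast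
  obtain cu CU where cu: "cu > 0" "CU > 0" and
    iu: "\<forall>x y. x \<notin> K \<longrightarrow> y \<notin> K \<longrightarrow>
          (\<exists>xs. walk (adjG K adj) xs \<and> hd xs = x \<and> last xs = y \<and>
             real (length xs - 1) \<le> CU * real (dG K adj x y) \<and>
             (\<forall>j < length xs. \<forall>z\<in>outer_bdry K adj.
                cu * (1 + real (min j (length xs - 1 - j))) \<le> real (gdist adj (xs ! j) z)))"
    using assms(6) unfolding inner_uniform_def by blast
  interpret inner_unif adj mu wt Cc c1 c2 c3 c4 K cu CU
  proof unfold_locales
    fix x y assume "x \<notin> K" "y \<notin> K"
    then show "\<exists>xs. walk (adjG K adj) xs \<and> hd xs = x \<and> last xs = y \<and>
         real (length xs - 1) \<le> CU * real (dG K adj x y) \<and>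
         (\<forall>j < length xs. \<forall>z\<in>outer_bdry K adj.
            cu * (1 + real (min j (length xs - 1 - j))) \<le> real (gdist adj (xs ! j) z))"
      using iu by blast
  qed (use assms(1,5) c heat Cc cu in auto)
  show ?thesis
  proof (intro conjI impI)
    assume "unif_S_transient adj mu wt K"
    then obtain C where "C > 0" "\<forall>x. x \<notin> K \<longrightarrow> bdry_sum K adj wt x \<le> ennreal C"
      using bdry_sum_bounded_if_transient by blast
    then show "\<exists>L' \<epsilon>'. L' > 0 \<and> \<epsilon>' > 0 \<and>
               (\<forall>x. x \<notin> K \<longrightarrow> (\<forall>k\<in>K. L' \<le> real (gdist adj x k)) \<longrightarrow>
                  bdry_sum K adj wt x \<le> ennreal \<epsilon>')"
      by (intro exI[of _ 1] exI[of _ C]) auto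
  qed (rule transient_if_bdry_sum_small)
qed

end
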